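(* Let $\phi,\psi$ be as in the context and let $h>0$. The process $\mathrm N^l(Y^h)$ with $Y^h_0=-1+h$ jumps for the first time after an exponential waiting time with rate $\mathcal G_0$, and at this jump it lands on $-1+(1+j)h$ with probability \[ -\frac{1}{\mathcal G_0}\sum_{i=0}^{j}\mathcal G_i\qquad\text{for each } j\ge1 . \] The process $\mathrm N^r(Y^h)$ with $Y^h_0=1-h$ jumps for the first time after an exponential waiting time with rate $\mathcal G_0$, and it lands on $1-2h$.
   Context: $\phi$ is a nonnegative Borel measure on $(0,\infty)$ with $\int_{(0,\infty)}(y^2\wedge y)\,\phi(dy)<\infty$ and $\int_{(0,1)}y\,\phi(dy)=\infty$; $\psi(\xi)=\int_{(0,\infty)}(e^{-\xi y}-1+\xi y)\,\phi(dy)$, $\Re\xi\ge0$. For $h>0$ the coefficients $\mathcal G_j=\mathcal G_{j,h}$, $j\ge0$, are defined by $\psi((1-\xi)/h)=\sum_{j=0}^\infty\mathcal G_j\xi^j$, $|\xi|<1$. They satisfy $\mathcal G_0>0$, $-\mathcal G_1>0$, $\mathcal G_j>0$ for $j\ge2$ and $-\mathcal G_1=\sum_{j\ne1}\mathcal G_j$. $Y^h$ is the (càdlàg) compound Poisson process with generator $\sum_{j=0}^\infty g(x+(j-1)h)\,\mathcal G_j$, i.e. it jumps by $(j-1)h$ at rate $\mathcal G_j$, $j\ne1$. For càdlàg paths $f$, $\mathrm N^l(f)=f(A_f^{-1})$ with $A_f(t)=\int_0^t\mathbf 1_{\{f(z)>-1\}}dz$ (for paths spending infinite time in $(-1,\infty)$)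 and $\mathrm N^r(f)=f(A_f^{-1})$ with $A_f(t)=\int_0^t\mathbf 1_{\{f(z)<1\}}dz$ (for paths spending infinite time in $(-\infty,1)$), where $A_f^{-1}(t)=\inf\{s>0:A_f(s)>t\}$. Almost surely the paths of $Y^h$ are in the domains of these maps. *)

theory Defs
  imports "HOL-Probability.Probability"
begin

definition psi :: "real measure \<Rightarrow> complex \<Rightarrow> complex" where
  "psi \<phi> \<xi> = (LINT y|\<phi>. exp (- \<xi> * complex_of_real y) - 1 + \<xi> * complex_of_real y)"

text \<open>The power series coefficients of \<open>\<xi> \<mapsto> \<psi>((1 - \<xi>)/h)\<close> on the open unit disc. They exist
  and are real because the function is holomorphic there and real on \<open>(-1, 1)\<close>.\<close>

definition Gcoeff :: "real measure \<Rightarrow> real \<Rightarrow> nat \<Rightarrow> real" where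
  "Gcoeff \<phi> h = (THE g. \<forall>\<xi>::complex. norm \<xi> < 1 \<longrightarrow>
      (\<lambda>j. complex_of_real (g j) * \<xi> ^ j) sums psi \<phi> ((1 - \<xi>) / complex_of_real h))"

text \<open>
  Compound Poisson process started at \<open>x\<close> with finite jump measure \<open>\<nu>\<close>: it jumps by an element
  of \<open>B\<close> at rate \<open>\<nu> B\<close>. The interarrival times \<open>E k\<close> are exponential with the total rate, the
  jump sizes \<open>Z k\<close> have the normalised jump measure as law, and all of them are independent;
  the \<open>k\<close>-th jump (counting from 0) occurs at time \<open>E 0 + \<dots> + E k\<close>. The paths agree
  almost surely with these right-continuous step functions.
\<close>

definition compound_poisson ::
  "'w measure \<Rightarrow> real measure \<Rightarrow> real \<Rightarrow> (real \<Rightarrow> 'w \<Rightarrow> real) \<Rightarrow> bool" where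
  "compound_poisson M \<nu> x Y \<longleftrightarrow>
     prob_space M \<and> finite_measure \<nu> \<and> sets \<nu> = sets borel \<and>
     (\<forall>t\<ge>0. Y t \<in> borel_measurable M) \<and>
     (\<exists>E Z :: nat \<Rightarrow> 'w \<Rightarrow> real.
        prob_space.indep_vars M (\<lambda>_. borel) (case_sum E Z) UNIV \<and>
        (\<forall>k. distributed M lborel (E k) (exponential_density (measure \<nu> UNIV))) \<and>
        (\<forall>k. \<forall>B\<in>sets borel.
           measure M (Z k -` B \<inter> space M) = measure \<nu> B / measure \<nu> UNIV) \<and>
        (AE \<omega> in M. \<forall>t\<ge>0.
           Y t \<omega> = x + (\<Sum>k | (\<Sum>i\<le>k. E i \<omega>) \<le> t. Z k \<omega>)))"

text \<open>Mass \<open>\<G>\<^sub>j\<close> at \<open>(j - 1)h\<close> for every \<open>j \<noteq> 1\<close>.\<close>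

definition jump_measure :: "real measure \<Rightarrow> real \<Rightarrow> real measure" where
  "jump_measure \<phi> h =
     distr (density (count_space (UNIV - {1})) (\<lambda>j. ennreal (Gcoeff \<phi> h j)))
       borel (\<lambda>j::nat. (real j - 1) * h)"

text \<open>
  Paths are functions on the nonnegative half-line; their values at negative times are never used.
  \<open>time_in D f t\<close> is the time up to \<open>t\<close> that \<open>f\<close> spends in \<open>D\<close>, and \<open>delete_outside D f\<close> is \<open>f\<close>
  run on the clock that only advances while \<open>f\<close> is in \<open>D\<close>. It is meaningful for paths that
  spend infinite time in \<open>D\<close>.
\<close>

definition time_in :: "real set \<Rightarrow> (real \<Rightarrow> real) \<Rightarrow> real \<Rightarrow> real" where
  "time_in D f t = (LBINT z:{0..t}. indicator D (f z))"

definition delete_outside :: "real set \<Rightarrow> (real \<Rightarrow> real) \<Rightarrow> real \<Rightarrow> real" where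
  "delete_outside D f t = f (Inf {s. s > 0 \<and> time_in D f s > t})"

definition Nl :: "(real \<Rightarrow> real) \<Rightarrow> real \<Rightarrow> real" where
  "Nl = delete_outside {-1<..}"

definition Nr :: "(real \<Rightarrow> real) \<Rightarrow> real \<Rightarrow> real" where
  "Nr = delete_outside {..<1}"

definition jumps_at :: "(real \<Rightarrow> real) \<Rightarrow> real \<Rightarrow> bool" where
  "jumps_at f t \<longleftrightarrow> t > 0 \<and> \<not> (f \<longlongrightarrow> f t) (at_left t)"

definition is_first_jump_time :: "(real \<Rightarrow> real) \<Rightarrow> real \<Rightarrow> bool" where
  "is_first_jump_time f t \<longleftrightarrow> jumps_at f t \<and> (\<forall>s<t. \<not> jumps_at f s)"

end

theory Submission
  imports Defs
begin

text \<open>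
  Write \<open>u = y / h\<close>. Expanding \<open>exp (- (1 - \<xi>) u) - 1 + (1 - \<xi>) u\<close> in powers of \<open>\<xi>\<close> and
  integrating term by term up to and including \<open>\<xi> = 1\<close> shows that the \<open>\<G>\<^sub>j\<close> sum to zero and that
  the jump chain, a downward skip-free random walk, has mean zero. In both cases the start \<open>x\<close> is
  the only position in the live region that the path can visit before the observed jump: for
  \<open>N\<^sup>l\<close> that jump is the first passage of the chain above \<open>x\<close>, for \<open>N\<^sup>r\<close> the first passage below
  \<open>x\<close>. So the observed waiting time is the sum of the holding times over the visits to \<open>x\<close>. If
  \<open>p\<close> is the probability of a down-step, the number of visits is geometric with success
  probability \<open>p\<close>, and a geometric sum of exponential times of rate \<open>-\<G>\<^sub>1\<close> is exponential of rate
  \<open>- p \<G>\<^sub>1 = \<G>\<^sub>0\<close>.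

  That the chain almost surely passes below its start follows from the exponential martingale of a
  skip-free walk. For the passage above the start, the Green function of the chain killed at this
  passage is the constant \<open>1 / p\<close> on the positions at or below \<open>x\<close>; its truncation at time \<open>n\<close>
  differs from this constant by a survival probability of the time-reversed walk, which is the
  downward case again. The last-step decomposition then gives the overshoot law.
\<close>

section \<open>Time change of step paths\<close>

text \<open>What one holding interval of length \<open>l\<close>, started at \<open>a\<close>,
  contributes to an occupation time up to \<open>t\<close>.\<close>

lemma measure_clamp:
  fixes a l t :: real
  assumes "0 \<le> a" "0 \<le> l" "0 \<le> t"
  shows "measure lborel ({a..<a + l} \<inter> {0..t}) = min (max (t - a) 0) l"
proof -
  consider "t < a" | "a \<le> t" "t < a + l" | "a + l \<le> t" by linarith
  then show ?thesis
  proof cases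
    case 1
    then have "{a..<a + l} \<inter> {0..t} = {}" by auto
    with 1 assms show ?thesis by simp
  next
    case 2
    then have "{a..<a + l} \<inter> {0..t} = {a..t}" using assms by auto
    with 2 show ?thesis by simp
  next
    case 3
    then have "{a..<a + l} \<inter> {0..t} = {a..<a+l}" using assms by auto
    with 3 assms show ?thesis by simp
  qed
qed

text \<open>
  Only the values of the path up to the end of the \<open>m\<close>-th holding interval are prescribed: what
  happens later cannot move the infimum in \<^const>\<open>delete_outside\<close>.
\<close>

locale step_path =
  fixes D :: "real set" and f :: "real \<Rightarrow> real" and e X :: "nat \<Rightarrow> real" and m :: nat
  assumes e_pos: "0 < e n"
    and path: "n \<le> m \<Longrightarrow> (\<Sum>i<n. e i) \<le> t \<Longrightarrow> t < (\<Sum>i<Suc n. e i) \<Longrightarrow> f t = X n"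
begin

definition jump_time :: "nat \<Rightarrow> real" where
  "jump_time n = (\<Sum>i<n. e i)"

text \<open>The reading of the clock \<open>time_in D f\<close> at \<open>jump_time n\<close>, for
  \<open>n \<le> m\<close>.\<close>

definition live_time :: "nat \<Rightarrow> real" where
  "live_time n = (\<Sum>i<n. indicator D (X i) * e i)"

lemma jump_time_simps [simp]:
  "jump_time 0 = 0" "jump_time (Suc n) = jump_time n + e n"
  by (simp_all add: jump_time_def)

lemma live_time_simps [simp]:
  "live_time 0 = 0" "live_time (Suc n) = live_time n + indicator D (X n) * e n"
  by (simp_all add: live_time_def)

lemma jump_time_mono: "i \<le> j \<Longrightarrow> jump_time i \<le> jump_time j"
  unfolding jump_time_def using e_pos by (intro sum_mono2) (auto intro: less_imp_le)

lemma jump_time_nonneg: "0 \<le> jump_time n"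
  using jump_time_mono[of 0 n] by simp

lemma live_time_mono: "i \<le> j \<Longrightarrow> live_time i \<le> live_time j"
  unfolding live_time_def using e_pos
  by (intro sum_mono2) (auto intro: less_imp_le mult_nonneg_nonneg)

lemma find_step:
  assumes "0 \<le> t" "t < jump_time (Suc m)"
  obtains n where "n \<le> m" "jump_time n \<le> t" "t < jump_time (Suc n)"
proof -
  define n where "n = (LEAST n. t < jump_time (Suc n))"
  have 1: "t < jump_time (Suc n)" unfolding n_def by (rule LeastI) (rule assms)
  have 2: "n \<le> m" unfolding n_def by (rule Least_le) (rule assms)
  have 3: "jump_time n \<le> t"
  proof (cases n)
    case (Suc k)
    then have "\<not> t < jump_time (Suc k)" using not_less_Least[of k "\<lambda>n. t < jump_time (Suc n)"] n_def by auto
    then show ?thesis using Suc by simp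
  qed (use assms in simp)
  show thesis using that 1 2 3 by blast
qed

lemma f_step: "n \<le> m \<Longrightarrow> jump_time n \<le> t \<Longrightarrow> t < jump_time (Suc n) \<Longrightarrow> f t = X n"
  using path unfolding jump_time_def by blast

text \<open>The holding intervals tile \<open>{0..t}\<close>, so the integrand is a finite sum of
  indicators and each summand integrates to an overlap length.\<close>

lemma time_in_eq:
  assumes t: "0 \<le> t" "t < jump_time (Suc m)"
  shows "time_in D f t =
    (\<Sum>i\<le>m. indicator D (X i) * min (max (t - jump_time i) 0) (e i))"
proof -
  let ?A = "\<lambda>i. {jump_time i..<jump_time i + e i} \<inter> {0..t}"
  have "indicator {0..t} z *\<^sub>R indicator D (f z) =
      (\<Sum>i\<le>m. indicator D (X i) * indicator (?A i) z :: real)" for z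
  proof (cases "z \<in> {0..t}")
    case True
    with t obtain n where n: "n \<le> m" "jump_time n \<le> z" "z < jump_time (Suc n)"
      using find_step[of z] by auto
    have "indicator D (X i) * indicator (?A i) z = (if i = n then indicator D (X n) else 0 :: real)" for i
    proof (cases i n rule: linorder_cases)
      case less
      with jump_time_mono[of "Suc i" n] n have "z \<notin> ?A i" by auto
      with less show ?thesis by simp
    next
      case equal
      with n True show ?thesis by simp
    next
      case greater
      with jump_time_mono[of "Suc n" i] n have "z \<notin> ?A i" by auto
      with greater show ?thesis by simp
    qed
    with n True f_step[OF n] show ?thesis by simp
  qed auto
  then have "time_in D f t = (\<integral>z. (\<Sum>i\<le>m. indicator D (X i) * indicator (?A i) z) \<partial>lborel)"
    unfolding time_in_def set_lebesgue_integral_def by simp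
  also have "\<dots> = (\<Sum>i\<le>m. \<integral>z. indicator D (X i) * indicator (?A i) z \<partial>lborel)"
  proof (intro Bochner_Integration.integral_sum integrable_mult_right)
    fix i
    have "emeasure lborel (?A i) \<le> emeasure lborel {0..t}" by (intro emeasure_mono) auto
    also have "\<dots> < \<infinity>" using t by simp
    finally show "integrable lborel (indicator (?A i) :: real \<Rightarrow> real)"
      by (intro integrable_real_indicator) auto
  qed
  also have "\<dots> = (\<Sum>i\<le>m. indicator D (X i) * min (max (t - jump_time i) 0) (e i))"
    using measure_clamp[OF jump_time_nonneg less_imp_le[OF e_pos] t(1)] by simp
  finally show ?thesis .
qed

text \<open>Each summand of the explicit formula is monotone in time. Working from the formula keeps
  the claim on the range where the path is prescribed.\<close>

lemma time_in_mono:
  assumes "0 \<le> s" "s \<le> t" "t < jump_time (Suc m)"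
  shows "time_in D f s \<le> time_in D f t"
  using assms by (subst (1 2) time_in_eq) (auto intro!: sum_mono mult_left_mono)

lemma time_in_step:
  assumes n: "n \<le> m" and r: "0 \<le> r" "r < e n"
  shows "time_in D f (jump_time n + r) = live_time n + indicator D (X n) * r"
proof -
  have lt: "jump_time n + r < jump_time (Suc m)"
    using jump_time_mono[of "Suc n" "Suc m"] n r by simp
  let ?g = "\<lambda>i. indicator D (X i) * min (max (jump_time n + r - jump_time i) 0) (e i) :: real"
  have "time_in D f (jump_time n + r) = (\<Sum>i\<le>m. ?g i)"
    using time_in_eq[OF _ lt] jump_time_nonneg[of n] r by simp
  also have "\<dots> = (\<Sum>i\<le>n. ?g i)"
  proof (rule sum.mono_neutral_right)
    show "\<forall>i\<in>{..m} - {..n}. ?g i = 0"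
    proof
      fix i assume "i \<in> {..m} - {..n}"
      then have "jump_time n + r - jump_time i \<le> 0" using jump_time_mono[of "Suc n" i] r by simp
      then show "?g i = 0" using e_pos[of i] by simp
    qed
  qed (use n in auto)
  also have "\<dots> = (\<Sum>i<n. ?g i) + ?g n" by (simp add: lessThan_Suc_atMost[symmetric])
  also have "(\<Sum>i<n. ?g i) = live_time n" unfolding live_time_def
  proof (rule sum.cong)
    fix i assume "i \<in> {..<n}"
    then have "e i \<le> jump_time n + r - jump_time i" using jump_time_mono[of "Suc i" n] r by simp
    then show "?g i = indicator D (X i) * e i" using e_pos[of i] by simp
  qed simp
  also have "?g n = indicator D (X n) * r" using r by simp
  finally show ?thesis .
qed

text \<open>During a live interval the clock runs at unit speed, so its right-continuous inverse at
  \<open>t\<close> is the point \<open>s\<close> of this interval where the clock reads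
  \<open>t\<close>.\<close>

lemma delete_outside_step:
  assumes n: "n \<le> m" "X n \<in> D" and t: "live_time n \<le> t" "t < live_time n + e n"
  shows "delete_outside D f t = X n"
proof -
  define s where "s = jump_time n + (t - live_time n)"
  have s: "0 \<le> s" "jump_time n \<le> s" "s < jump_time (Suc n)"
    using t jump_time_nonneg[of n] by (auto simp: s_def)
  have lt: "jump_time (Suc n) \<le> jump_time (Suc m)" using n by (intro jump_time_mono) simp
  have A: "time_in D f s = t"
    using time_in_step[OF n(1), of "t - live_time n"] t n(2) by (simp add: s_def)
  let ?S = "{s. s > 0 \<and> time_in D f s > t}"
  \<comment> \<open>A candidate below \<open>s\<close> lies in the prescribed range, where
    monotonicity applies; candidates beyond that range are above \<open>s\<close> anyway.\<close>
  have low: "s \<le> x" if "x \<in> ?S" for x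
  proof (rule ccontr)
    assume "\<not> s \<le> x"
    then have "time_in D f x \<le> time_in D f s" using that s lt by (intro time_in_mono) auto
    with A that show False by simp
  qed
  \<comment> \<open>The clock exceeds \<open>t\<close> immediately after \<open>s\<close>, so
    \<open>s\<close> is the infimum although it is not in the set.\<close>
  have mem: "x \<in> ?S" if "s < x" "x < jump_time (Suc n)" for x
    using time_in_step[OF n(1), of "x - jump_time n"] that s n(2) by (auto simp: s_def)
  have "Inf ?S = s"
  proof (rule cInf_eq_non_empty)
    show "?S \<noteq> {}" using mem dense[OF s(3)] by blast
    fix y assume y: "\<And>x. x \<in> ?S \<Longrightarrow> y \<le> x"
    show "y \<le> s"
    proof (rule dense_ge_bounded[OF s(3)])
      fix x assume "s < x" "x < jump_time (Suc n)"
      then show "y \<le> x" using mem y by blast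
    qed
  qed (use low in blast)
  then show ?thesis unfolding delete_outside_def using f_step[OF n(1) s(2,3)] by simp
qed

text \<open>All live positions before index \<open>m\<close> coincide with the start, so after
  deletion of the dead intervals the path is constant up to \<open>live_time m\<close> and then
  takes the value \<open>X m\<close>.\<close>

lemma first_jump:
  assumes X0: "X 0 \<in> D" and Xm: "X m \<in> D" "X m \<noteq> X 0"
    and live: "\<And>n. n < m \<Longrightarrow> X n \<in> D \<Longrightarrow> X n = X 0"
  shows "is_first_jump_time (delete_outside D f) (live_time m)"
    and "delete_outside D f (live_time m) = X m"
proof -
  let ?g = "delete_outside D f"
  show at_end: "?g (live_time m) = X m"
    using Xm e_pos[of m] by (intro delete_outside_step) auto
  have before: "?g t = X 0" if t: "0 \<le> t" "t < live_time m" for t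
  proof -
    \<comment> \<open>The clock has to increase during interval \<open>n - 1\<close>, which makes
      that interval live.\<close>
    define n where "n = (LEAST n. t < live_time n)"
    have 1: "t < live_time n" unfolding n_def by (rule LeastI) (rule t)
    have 2: "n \<le> m" unfolding n_def by (rule Least_le) (rule t)
    have "n \<noteq> 0" using 1 t by (metis live_time_simps(1) not_less)
    then obtain k where k: "n = Suc k" using not0_implies_Suc by blast
    have 3: "live_time k \<le> t"
      using not_less_Least[of k "\<lambda>n. t < live_time n"] k n_def by auto
    have 4: "X k \<in> D" using 1 3 k by (cases "X k \<in> D") auto
    have "?g t = X k" using 1 2 3 4 k by (intro delete_outside_step) auto
    with live[OF _ 4] 2 k show ?thesis by simp
  qed
  have m: "0 < m" using Xm by (cases m) auto
  have pos: "0 < live_time m"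
    using live_time_mono[of "Suc 0" m] m X0 e_pos[of 0] by simp
  have lim: "(?g \<longlongrightarrow> X 0) (at_left t)" if t: "0 < t" "t \<le> live_time m" for t
  proof (rule tendsto_eventually)
    have "eventually (\<lambda>s. s \<in> {0<..<t}) (at_left t)"
      using t by (intro eventually_at_leftI[of 0]) auto
    then show "\<forall>\<^sub>F s in at_left t. ?g s = X 0"
      by eventually_elim (use before t in auto)
  qed
  have "jumps_at ?g (live_time m)"
    unfolding jumps_at_def
    using pos lim[of "live_time m"] Xm(2) at_end
    by (auto dest: tendsto_unique[OF trivial_limit_at_left_real])
  moreover have "\<not> jumps_at ?g s" if "s < live_time m" for s
    using lim[of s] before[of s] that by (auto simp: jumps_at_def)
  ultimately show "is_first_jump_time ?g (live_time m)"
    by (simp add: is_first_jump_time_def)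
qed

end

section \<open>The coefficients of the symbol\<close>

text \<open>Dominated exchange of sum and integral with \<open>S\<close>, the pointwise sum of the
  norms, as majorant; its integral bounds all partial sums of the norm integrals.\<close>

lemma integral_sums_of_summable_norm:
  fixes f :: "nat \<Rightarrow> 'a \<Rightarrow> 'b::{banach, second_countable_topology}"
  assumes f[measurable]: "\<And>j. f j \<in> borel_measurable M"
    and sums: "\<And>x. x \<in> space M \<Longrightarrow> (\<lambda>j. norm (f j x)) sums S x"
    and S: "integrable M S"
  shows "integrable M (f j)"
    and "(\<lambda>j. \<integral>x. f j x \<partial>M) sums (\<integral>x. (\<Sum>j. f j x) \<partial>M)"
proof -
  have partial: "(\<Sum>j\<in>A. norm (f j x)) \<le> S x" if "x \<in> space M" "finite A" for x A
    using sums[OF that(1)] that(2) sum_le_suminf[of "\<lambda>j. norm (f j x)" A]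
    by (auto simp: sums_iff)
  show int: "integrable M (f j)" for j
    by (rule Bochner_Integration.integrable_bound[OF S f])
       (use partial[of _ "{j}"] in \<open>auto intro!: AE_I2 intro: order_trans[OF _ abs_ge_self]\<close>)
  show "(\<lambda>j. \<integral>x. f j x \<partial>M) sums (\<integral>x. (\<Sum>j. f j x) \<partial>M)"
  proof (rule sums_integral[OF int])
    show "AE x in M. summable (\<lambda>j. norm (f j x))"
      using sums by (intro AE_I2) (auto simp: sums_iff)
    show "summable (\<lambda>j. \<integral>x. norm (f j x) \<partial>M)"
    proof (rule summableI_nonneg_bounded)
      fix n
      have "(\<Sum>j<n. \<integral>x. norm (f j x) \<partial>M) = (\<integral>x. (\<Sum>j<n. norm (f j x)) \<partial>M)"
        using int by (subst Bochner_Integration.integral_sum) auto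
      also have "\<dots> \<le> (\<integral>x. S x \<partial>M)"
        using int S partial by (intro integral_mono) auto
      finally show "(\<Sum>j<n. \<integral>x. norm (f j x) \<partial>M) \<le> (\<integral>x. S x \<partial>M)" .
    qed auto
  qed
qed

text \<open>The coefficients of \<open>\<xi> \<mapsto> exp (- (1 - \<xi>) u) - 1 + (1 - \<xi>) u\<close>.\<close>

definition taylor_term :: "nat \<Rightarrow> real \<Rightarrow> real" where
  "taylor_term j u = exp (- u) * u ^ j / fact j + (if j = 0 then u - 1 else if j = 1 then - u else 0)"

lemma taylor_term_0: "taylor_term 0 u = exp (- u) - 1 + u"
  and taylor_term_1: "taylor_term (Suc 0) u = - (u * (1 - exp (- u)))"
  and taylor_term_ge_2: "2 \<le> j \<Longrightarrow> taylor_term j u = exp (- u) * u ^ j / fact j"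
  by (auto simp: taylor_term_def algebra_simps)

lemma taylor_term_measurable [measurable]: "taylor_term j \<in> borel_measurable borel"
  unfolding taylor_term_def[abs_def] by measurable

lemma exp_sums_complex: "(\<lambda>j. z ^ j / fact j) sums exp (z :: complex)"
  using exp_converges[of z] by (simp add: scaleR_conv_of_real divide_inverse mult.commute)

lemma exp_sums_real: "(\<lambda>j. z ^ j / fact j) sums exp (z :: real)"
  using exp_converges[of z] by (simp add: divide_inverse mult.commute)

lemma sums_if_0_1: "(\<lambda>j. if j = 0 then a else if j = 1 then b else 0) sums (a + b :: 'a :: real_normed_vector)"
  using sums_finite[of "{0, 1 :: nat}" "\<lambda>j. if j = 0 then a else if j = 1 then b else 0"] by simp

text \<open>Factor the exponential as exp(-u) exp(\<xi> u); the affine remainder only affects the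
  coefficients 0 and 1.\<close>

lemma taylor_sums:
  "(\<lambda>j. complex_of_real (taylor_term j u) * \<xi> ^ j) sums
    (exp (- (1 - \<xi>) * complex_of_real u) - 1 + (1 - \<xi>) * complex_of_real u)"
proof -
  have "(\<lambda>j. exp (- complex_of_real u) * ((\<xi> * complex_of_real u) ^ j / fact j) +
      (if j = 0 then complex_of_real u - 1 else if j = 1 then - \<xi> * complex_of_real u else 0)) sums
      (exp (- complex_of_real u) * exp (\<xi> * complex_of_real u) + (complex_of_real u - 1 + (- \<xi> * complex_of_real u)))"
    by (intro sums_add sums_mult exp_sums_complex sums_if_0_1)
  also have "exp (- complex_of_real u) * exp (\<xi> * complex_of_real u) + (complex_of_real u - 1 + (- \<xi> * complex_of_real u))
    = exp (- (1 - \<xi>) * complex_of_real u) - 1 + (1 - \<xi>) * complex_of_real u"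
    by (simp add: exp_add[symmetric] algebra_simps)
  also have "(\<lambda>j. exp (- complex_of_real u) * ((\<xi> * complex_of_real u) ^ j / fact j) +
      (if j = 0 then complex_of_real u - 1 else if j = 1 then - \<xi> * complex_of_real u else 0)) =
      (\<lambda>j. complex_of_real (taylor_term j u) * \<xi> ^ j)"
  proof
    fix j
    define E where "E = complex_of_real (exp (- u))"
    have E: "exp (- complex_of_real u) = E"
      unfolding E_def by (metis exp_of_real of_real_minus)
    define c where "c = complex_of_real u ^ j / fact j"
    have t: "complex_of_real (taylor_term j u) =
        E * c + (if j = 0 then complex_of_real u - 1 else if j = 1 then - complex_of_real u else 0)"
      by (simp add: taylor_term_def c_def E_def)
    have c: "(\<xi> * complex_of_real u) ^ j / fact j = \<xi> ^ j * c"
      by (simp add: c_def power_mult_distrib)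
    show "exp (- complex_of_real u) * ((\<xi> * complex_of_real u) ^ j / fact j) +
      (if j = 0 then complex_of_real u - 1 else if j = 1 then - \<xi> * complex_of_real u else 0) =
      complex_of_real (taylor_term j u) * \<xi> ^ j"
      unfolding t E c by (cases "j = 0"; cases "j = 1") (simp_all add: algebra_simps)
  qed
  finally show ?thesis .
qed

lemma taylor_sums_at_1: "(\<lambda>j. taylor_term j u) sums 0"
proof -
  have "(\<lambda>j. complex_of_real (taylor_term j u)) sums complex_of_real 0"
    using taylor_sums[of u 1] by simp
  then show ?thesis by (rule sums_of_real_iff[THEN iffD1])
qed

text \<open>The expanded function has a double zero at \<xi> = 1. The series is its derivative there
  minus its value there.\<close>

lemma taylor_drift_sums: "(\<lambda>j. (real j - 1) * taylor_term j u) sums 0"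
proof -
  have "real (Suc j) * (u ^ Suc j / fact (Suc j)) = u * (u ^ j / fact j)" for j
    by (simp add: field_simps del: of_nat_Suc)
  with sums_mult[OF exp_sums_real[of u], of u]
  have "(\<lambda>j. real (Suc j) * (u ^ Suc j / fact (Suc j))) sums (u * exp u)"
    by (simp only:)
  then have "(\<lambda>j. real j * (u ^ j / fact j)) sums (u * exp u + real 0 * (u ^ 0 / fact 0))"
    by (rule sums_Suc)
  then have "(\<lambda>j. real j * (u ^ j / fact j)) sums (u * exp u)" by simp
  then have "(\<lambda>j. exp (- u) * (real j * (u ^ j / fact j) - u ^ j / fact j) +
      (if j = 0 then 1 - u else if j = 1 then 0 else 0)) sums (exp (- u) * (u * exp u - exp u) + (1 - u + 0))"
    by (intro sums_add sums_mult sums_diff exp_sums_real sums_if_0_1)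
  also have "exp (- u) * (u * exp u - exp u) + (1 - u + 0) = 0"
    by (simp add: algebra_simps exp_add[symmetric])
  also have "(\<lambda>j. exp (- u) * (real j * (u ^ j / fact j) - u ^ j / fact j) +
      (if j = 0 then 1 - u else if j = 1 then 0 else 0)) = (\<lambda>j. (real j - 1) * taylor_term j u)"
  proof
    fix j
    define c where "c = u ^ j / fact j"
    have t: "taylor_term j u = exp (- u) * c + (if j = 0 then u - 1 else if j = 1 then - u else 0)"
      by (simp add: taylor_term_def c_def)
    show "exp (- u) * (real j * (u ^ j / fact j) - u ^ j / fact j) +
      (if j = 0 then 1 - u else if j = 1 then 0 else 0) = (real j - 1) * taylor_term j u"
      unfolding t c_def[symmetric] by (simp add: algebra_simps)
  qed
  finally show ?thesis .
qed

lemma taylor_term_0_nonneg: "0 \<le> taylor_term 0 u"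
  using exp_ge_add_one_self[of "- u"] by (simp add: taylor_term_0)

lemma taylor_term_0_pos: "0 < u \<Longrightarrow> 0 < taylor_term 0 u"
proof -
  assume u: "0 < u"
  show ?thesis
  proof (cases "u < 1")
    case True
    \<comment> \<open>Squaring the tangent bound for exp(-u/2) gains the term u^2/4, which gives
      strictness.\<close>
    have "(1 - u / 2)\<^sup>2 \<le> (exp (- u / 2))\<^sup>2"
      using exp_ge_add_one_self[of "- u / 2"] True by (intro power_mono) auto
    then have "1 - u + u\<^sup>2 / 4 \<le> exp (- u)"
      by (simp add: power2_eq_square algebra_simps exp_add[symmetric])
    moreover have "0 < u\<^sup>2" using u by simp
    ultimately show ?thesis unfolding taylor_term_0 by linarith
  next
    case False
    then show ?thesis using exp_gt_zero[of "- u"] unfolding taylor_term_0 by linarith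
  qed
qed

lemma taylor_term_1_nonpos: "0 \<le> u \<Longrightarrow> taylor_term (Suc 0) u \<le> 0"
  by (simp add: taylor_term_1)

lemma taylor_term_nonneg: "0 \<le> u \<Longrightarrow> j \<noteq> 1 \<Longrightarrow> 0 \<le> taylor_term j u"
  using taylor_term_0_nonneg[of u] by (cases "j = 0") (auto simp: taylor_term_ge_2)

text \<open>Only the coefficient 1 is negative and the plain sum is 0, so flipping its sign adds
  twice its absolute value.\<close>

lemma taylor_abs_sums:
  assumes "0 \<le> u"
  shows "(\<lambda>j. \<bar>taylor_term j u\<bar>) sums (- 2 * taylor_term (Suc 0) u)"
proof -
  have "(\<lambda>j. taylor_term j u + (if j = 0 then 0 else if j = 1 then 2 * (u * (1 - exp (- u))) else 0))
      sums (0 + (0 + 2 * (u * (1 - exp (- u)))))"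
    by (intro sums_add taylor_sums_at_1 sums_if_0_1)
  also have "(\<lambda>j. taylor_term j u + (if j = 0 then 0 else if j = 1 then 2 * (u * (1 - exp (- u))) else 0)) =
      (\<lambda>j. \<bar>taylor_term j u\<bar>)"
  proof
    fix j
    have "taylor_term (Suc 0) u + 2 * (u * (1 - exp (- u))) = - taylor_term (Suc 0) u"
      unfolding taylor_term_1 by linarith
    then show "taylor_term j u + (if j = 0 then 0 else if j = 1 then 2 * (u * (1 - exp (- u))) else 0) =
        \<bar>taylor_term j u\<bar>"
      using taylor_term_nonneg[OF assms, of j] taylor_term_1_nonpos[OF assms]
      by (cases "j = 1") (simp_all add: abs_of_nonpos)
  qed
  finally show ?thesis by (simp add: taylor_term_1)
qed

text \<open>Here only the term \<open>j = 0\<close> is negative, through the factor -1; the term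
  \<open>j = 1\<close> vanishes.\<close>

lemma taylor_drift_abs_sums:
  assumes "0 \<le> u"
  shows "(\<lambda>j. \<bar>(real j - 1) * taylor_term j u\<bar>) sums (2 * taylor_term 0 u)"
proof -
  have "(\<lambda>j. (real j - 1) * taylor_term j u + (if j = 0 then 2 * taylor_term 0 u else if j = 1 then 0 else 0))
      sums (0 + (2 * taylor_term 0 u + 0))"
    by (intro sums_add taylor_drift_sums sums_if_0_1)
  also have "(\<lambda>j. (real j - 1) * taylor_term j u + (if j = 0 then 2 * taylor_term 0 u else if j = 1 then 0 else 0)) =
      (\<lambda>j. \<bar>(real j - 1) * taylor_term j u\<bar>)"
  proof
    fix j
    show "(real j - 1) * taylor_term j u + (if j = 0 then 2 * taylor_term 0 u else if j = 1 then 0 else 0) =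
      \<bar>(real j - 1) * taylor_term j u\<bar>"
      using taylor_term_nonneg[OF assms, of j] by (cases "j = 0"; cases "j = 1") (simp_all add: abs_mult)
  qed
  finally show ?thesis by (simp only: add_0_left add_0_right)
qed

text \<open>The majorant through which the moment condition on \<phi> enters.\<close>

lemma one_minus_exp_le: "0 \<le> u \<Longrightarrow> u * (1 - exp (- u)) \<le> min (u\<^sup>2) (u :: real)"
  using exp_ge_add_one_self[of "- u"] mult_left_mono[of "1 - exp (- u)" u u]
  by (auto simp: power2_eq_square mult_left_le)

text \<open>A rewriting of (1 + u) exp(-u) \<le> 1. It passes integrability from coefficient 1 to
  coefficient 0.\<close>

lemma taylor_term_0_le: "0 \<le> u \<Longrightarrow> taylor_term 0 u \<le> - taylor_term (Suc 0) u"
proof -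
  assume "0 \<le> u"
  have "exp (- u) * (1 + u) \<le> exp (- u) * exp u" by (intro mult_left_mono) auto
  then show ?thesis by (simp add: taylor_term_0 taylor_term_1 algebra_simps exp_add[symmetric])
qed

text \<open>Otherwise divide the difference by \<xi>^m, with \<open>m\<close> the first index of
  disagreement, and let \<xi> tend to 0.\<close>

lemma powser_coeff_unique:
  fixes a b :: "nat \<Rightarrow> complex"
  assumes a: "\<And>\<xi>. norm \<xi> < 1 \<Longrightarrow> (\<lambda>j. a j * \<xi> ^ j) sums F \<xi>"
    and b: "\<And>\<xi>. norm \<xi> < 1 \<Longrightarrow> (\<lambda>j. b j * \<xi> ^ j) sums F \<xi>"
  shows "a = b"
proof (rule ccontr)
  assume "a \<noteq> b"
  define c where "c j = a j - b j" for j
  have c: "(\<lambda>j. c j * \<xi> ^ j) sums 0" if "norm \<xi> < 1" for \<xi>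
    using sums_diff[OF a[OF that] b[OF that]] by (simp add: c_def algebra_simps)
  from \<open>a \<noteq> b\<close> obtain n where "c n \<noteq> 0" by (auto simp: c_def fun_eq_iff)
  define m where "m = (LEAST n. c n \<noteq> 0)"
  have m: "c m \<noteq> 0" unfolding m_def by (rule LeastI) fact
  have less: "c i = 0" if "i < m" for i using not_less_Least[of i "\<lambda>n. c n \<noteq> 0"] that m_def by auto
  have d: "(\<lambda>j. c (j + m) * \<xi> ^ j) sums 0" if "norm \<xi> < 1" "\<xi> \<noteq> 0" for \<xi>
  proof -
    have "(\<lambda>j. c (j + m) * \<xi> ^ (j + m)) sums 0"
      using c[OF that(1)] less sums_iff_shift[of "\<lambda>j. c j * \<xi> ^ j" m 0] by simp
    then have "(\<lambda>j. \<xi> ^ m * (c (j + m) * \<xi> ^ j)) sums (\<xi> ^ m * 0)" by (simp add: power_add mult_ac)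
    then show ?thesis using that(2) by (subst (asm) sums_mult_iff) auto
  qed
  have "((\<lambda>_. 0) \<longlongrightarrow> c (0 + m)) (at (0 :: complex))"
    by (rule powser_limit_0_strong[of 1 "\<lambda>j. c (j + m)"]) (use d in auto)
  with m show False by (simp add: tendsto_const_iff)
qed

section \<open>The coefficients as integrals against \<phi>\<close>

locale spectrally_positive =
  fixes \<phi> :: "real measure" and h :: real
  assumes sets_phi: "sets \<phi> = sets (restrict_space borel {0<..})"
    and moment: "(\<integral>\<^sup>+ y. ennreal (min (y\<^sup>2) y) \<partial>\<phi>) < \<infinity>"
    and infinite_variation: "(\<integral>\<^sup>+ y\<in>{0<..<1}. ennreal y \<partial>\<phi>) = \<infinity>"
    and h_pos: "h > 0"
begin

lemma space_phi: "space \<phi> = {0<..}"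
  using sets_eq_imp_space_eq[OF sets_phi] by (simp add: space_restrict_space)

lemma measurable_phi [measurable (raw)]: "f \<in> borel_measurable borel \<Longrightarrow> f \<in> borel_measurable \<phi>"
  using measurable_cong_sets[OF sets_phi refl] measurable_restrict_space1 by blast

lemma integrable_moment: "integrable \<phi> (\<lambda>y. min (y\<^sup>2) y)"
proof (rule integrableI_nonneg)
  show "AE y in \<phi>. 0 \<le> min (y\<^sup>2) y" by (rule AE_I2) (auto simp: space_phi)
qed (use moment in auto)

text \<open>Passing from \<open>y\<close> to \<open>y / h\<close> changes the majorant min(y^2, y)
  by at most the factor max(1/h^2, 1/h).\<close>

lemma integrable_taylor_1: "integrable \<phi> (\<lambda>y. taylor_term (Suc 0) (y / h))"
proof (rule Bochner_Integration.integrable_bound)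
  show "integrable \<phi> (\<lambda>y. max (1 / h\<^sup>2) (1 / h) * min (y\<^sup>2) y)"
    using integrable_moment by simp
  show "AE y in \<phi>. norm (taylor_term (Suc 0) (y / h)) \<le> norm (max (1 / h\<^sup>2) (1 / h) * min (y\<^sup>2) y)"
  proof (rule AE_I2)
    fix y assume "y \<in> space \<phi>"
    then have y: "0 < y" by (simp add: space_phi)
    let ?C = "max (1 / h\<^sup>2) (1 / h)"
    have "(y / h) * (1 - exp (- (y / h))) \<le> min ((y / h)\<^sup>2) (y / h)"
      using y h_pos by (intro one_minus_exp_le) simp
    also have "\<dots> \<le> ?C * min (y\<^sup>2) y"
    proof -
      have "(1 / h\<^sup>2) * y\<^sup>2 \<le> ?C * y\<^sup>2" "(1 / h) * y \<le> ?C * y"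
        using y by (intro mult_right_mono; simp)+
      then have "(y / h)\<^sup>2 \<le> ?C * y\<^sup>2" "y / h \<le> ?C * y" by (simp_all only: power_divide) simp_all
      then show ?thesis
        by (cases "y\<^sup>2 \<le> y") (simp_all only: min_absorb1 min_absorb2 linear min.coboundedI1 min.coboundedI2 not_le less_imp_le)
    qed
    finally have le: "(y / h) * (1 - exp (- (y / h))) \<le> ?C * min (y\<^sup>2) y" .
    have "0 \<le> (y / h) * (1 - exp (- (y / h)))" using y h_pos by (intro mult_nonneg_nonneg) auto
    with le show "norm (taylor_term (Suc 0) (y / h)) \<le> norm (?C * min (y\<^sup>2) y)"
      unfolding real_norm_def taylor_term_1 abs_minus_cancel
      by (simp only: abs_of_nonneg order_trans[OF _ abs_ge_self])
  qed
qed measurable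

lemma integrable_taylor_0: "integrable \<phi> (\<lambda>y. taylor_term 0 (y / h))"
  by (rule Bochner_Integration.integrable_bound[OF integrable_taylor_1])
     (use h_pos in \<open>auto simp: space_phi taylor_term_0_nonneg taylor_term_1_nonpos abs_of_nonpos taylor_term_0_le
        intro!: AE_I2\<close>)

text \<open>An explicit formula for the coefficients; \<open>Gcoeff_eq\<close> identifies it with
  the description in \<open>Gcoeff\<close>.\<close>

definition G :: "nat \<Rightarrow> real" where
  "G j = (\<integral>y. taylor_term j (y / h) \<partial>\<phi>)"

lemma integrable_taylor: "integrable \<phi> (\<lambda>y. taylor_term j (y / h))"
  by (rule integral_sums_of_summable_norm(1)[of "\<lambda>j y. taylor_term j (y / h)" \<phi>
        "\<lambda>y. - 2 * taylor_term (Suc 0) (y / h)"])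
     (use h_pos taylor_abs_sums integrable_taylor_1 in \<open>auto simp: space_phi\<close>)

text \<open>The norms of the terms have an integrable sum even for |\<xi>| = 1. The boundary is
  included because \<xi> = 1 yields the zero sum of the coefficients.\<close>

lemma G_sums_psi:
  assumes "norm \<xi> \<le> 1"
  shows "(\<lambda>j. complex_of_real (G j) * \<xi> ^ j) sums psi \<phi> ((1 - \<xi>) / complex_of_real h)"
proof -
  let ?f = "\<lambda>j y. complex_of_real (taylor_term j (y / h)) * \<xi> ^ j"
  let ?S = "\<lambda>y. (\<Sum>j. norm (?f j y))"
  have norm_le: "norm (?f j y) \<le> \<bar>taylor_term j (y / h)\<bar>" for j y
    using assms power_le_one[of "norm \<xi>" j] by (auto simp: norm_mult norm_power intro!: mult_left_le)
  have abs_sums: "(\<lambda>j. \<bar>taylor_term j (y / h)\<bar>) sums (- 2 * taylor_term (Suc 0) (y / h))" if "y \<in> space \<phi>" for y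
    using that h_pos by (intro taylor_abs_sums) (auto simp: space_phi)
  have summable: "summable (\<lambda>j. norm (?f j y))" if "y \<in> space \<phi>" for y
    by (rule summable_comparison_test[of _ "\<lambda>j. \<bar>taylor_term j (y / h)\<bar>"])
       (use norm_le abs_sums[OF that] in \<open>auto simp: sums_iff simp del: abs_mult\<close>)
  have "(\<lambda>j. \<integral>y. ?f j y \<partial>\<phi>) sums (\<integral>y. (\<Sum>j. ?f j y) \<partial>\<phi>)"
  proof (rule integral_sums_of_summable_norm(2))
    show "(\<lambda>j. norm (?f j y)) sums ?S y" if "y \<in> space \<phi>" for y
      using summable[OF that] by (rule summable_sums)
    show "integrable \<phi> ?S"
    proof (rule Bochner_Integration.integrable_bound)
      show "integrable \<phi> (\<lambda>y. - 2 * taylor_term (Suc 0) (y / h))"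
        using integrable_taylor_1 by simp
      show "AE y in \<phi>. norm (?S y) \<le> norm (- 2 * taylor_term (Suc 0) (y / h))"
      proof (rule AE_I2)
        fix y assume y: "y \<in> space \<phi>"
        have "0 \<le> ?S y" using summable[OF y] by (intro suminf_nonneg) auto
        moreover have "?S y \<le> (\<Sum>j. \<bar>taylor_term j (y / h)\<bar>)"
          using summable[OF y] abs_sums[OF y] norm_le by (intro suminf_le) (auto simp: sums_iff)
        ultimately show "norm (?S y) \<le> norm (- 2 * taylor_term (Suc 0) (y / h))"
          using abs_sums[OF y] by (simp add: sums_iff)
      qed
    qed measurable
  qed measurable
  moreover have "(\<integral>y. ?f j y \<partial>\<phi>) = complex_of_real (G j) * \<xi> ^ j" for j
    using integrable_taylor[of j] by (simp add: G_def)
  moreover have "(\<Sum>j. ?f j y) = exp (- ((1 - \<xi>) / complex_of_real h) * complex_of_real y) - 1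
      + ((1 - \<xi>) / complex_of_real h) * complex_of_real y" for y
  proof -
    have "(1 - \<xi>) * complex_of_real (y / h) = (1 - \<xi>) / complex_of_real h * complex_of_real y"
      "- (1 - \<xi>) * complex_of_real (y / h) = - ((1 - \<xi>) / complex_of_real h) * complex_of_real y"
      by (simp_all add: minus_divide_left)
    with sums_unique[OF taylor_sums[of "y / h" \<xi>]] show ?thesis by (simp only:)
  qed
  ultimately show ?thesis unfolding psi_def by (simp only:)
qed

lemma Gcoeff_eq: "Gcoeff \<phi> h = G"
  unfolding Gcoeff_def
proof (rule the_equality)
  show "\<forall>\<xi>. norm \<xi> < 1 \<longrightarrow> (\<lambda>j. complex_of_real (G j) * \<xi> ^ j) sums psi \<phi> ((1 - \<xi>) / complex_of_real h)"
    using G_sums_psi by simp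
  fix g assume "\<forall>\<xi>. norm \<xi> < 1 \<longrightarrow> (\<lambda>j. complex_of_real (g j) * \<xi> ^ j) sums psi \<phi> ((1 - \<xi>) / complex_of_real h)"
  then have "(\<lambda>j. complex_of_real (g j)) = (\<lambda>j. complex_of_real (G j))"
    using G_sums_psi by (intro powser_coeff_unique) auto
  then show "g = G" by (simp add: fun_eq_iff)
qed

lemma G_sums_0: "G sums 0"
proof -
  have "(\<lambda>j. complex_of_real (G j)) sums psi \<phi> 0" using G_sums_psi[of 1] by simp
  then have "(\<lambda>j. complex_of_real (G j)) sums complex_of_real 0" by (simp add: psi_def)
  then show ?thesis by (rule sums_of_real_iff[THEN iffD1])
qed

text \<open>Integrates \<open>taylor_drift_sums\<close>; it becomes the centredness of the jump
  chain.\<close>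

lemma G_drift_sums_0: "(\<lambda>j. (real j - 1) * G j) sums 0"
proof -
  have "(\<lambda>j. \<integral>y. (real j - 1) * taylor_term j (y / h) \<partial>\<phi>) sums
      (\<integral>y. (\<Sum>j. (real j - 1) * taylor_term j (y / h)) \<partial>\<phi>)"
    by (rule integral_sums_of_summable_norm(2)[where S = "\<lambda>y. 2 * taylor_term 0 (y / h)"])
       (use h_pos taylor_drift_abs_sums integrable_taylor_0 in \<open>auto simp: space_phi simp del: abs_mult\<close>)
  then show ?thesis using taylor_drift_sums by (simp add: G_def sums_iff)
qed

lemma G_nonneg: "j \<noteq> 1 \<Longrightarrow> 0 \<le> G j"
  unfolding G_def using h_pos
  by (intro Bochner_Integration.integral_nonneg_AE AE_I2 taylor_term_nonneg) (auto simp: space_phi)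

text \<open>The integrand is strictly positive on (0, \<infinity>), so a vanishing integral would
  leave \<phi> without mass there, against the infinite variation.\<close>

lemma G_0_pos: "0 < G 0"
proof -
  have nn: "AE y in \<phi>. 0 \<le> taylor_term 0 (y / h)" by (simp add: taylor_term_0_nonneg)
  have "G 0 \<noteq> 0"
  proof
    assume "G 0 = 0"
    then have "AE y in \<phi>. taylor_term 0 (y / h) = 0"
      unfolding G_def using integral_nonneg_eq_0_iff_AE[OF integrable_taylor_0 nn] by simp
    then have "AE y in \<phi>. ennreal y * indicator {0<..<1} y = 0"
      using AE_space by eventually_elim 
        (metis divide_pos_pos greaterThan_iff h_pos less_irrefl space_phi taylor_term_0_pos)
    then have "(\<integral>\<^sup>+ y\<in>{0<..<1}. ennreal y \<partial>\<phi>) = (\<integral>\<^sup>+ y. 0 \<partial>\<phi>)"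
      by (rule nn_integral_cong_AE)
    with infinite_variation show False by simp
  qed
  with G_nonneg[of 0] show ?thesis by simp
qed

text \<open>All coefficients sum to 0 and those from index 2 on are nonnegative, so
  \<open>G 0 + G 1 \<le> 0\<close>.\<close>

lemma G_1_neg: "G 1 < 0"
proof -
  have "G 0 + G 1 \<le> 0"
  proof -
    have s: "(\<lambda>j. G (j + 2)) sums (0 - (\<Sum>j<2. G j))"
      by (rule sums_split_initial_segment[OF G_sums_0])
    have "0 \<le> (\<Sum>j. G (j + 2))" using s G_nonneg by (intro suminf_nonneg) (auto simp: sums_iff)
    with s show ?thesis by (simp add: sums_iff numeral_2_eq_2)
  qed
  with G_0_pos show ?thesis by simp
qed

end

section \<open>Survival of a critical downward skip-free walk\<close>

text \<open>The probability that the walk with steps \<open>j - 1\<close>, \<open>j\<close> of law \<open>P\<close>, started at \<open>k\<close>, stays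
  nonnegative up to time \<open>n\<close>.\<close>

primrec survival :: "nat pmf \<Rightarrow> nat \<Rightarrow> int \<Rightarrow> real" where
  "survival P 0 k = (if 0 \<le> k then 1 else 0)"
| "survival P (Suc n) k = (if 0 \<le> k then measure_pmf.expectation P (\<lambda>j. survival P n (k + int j - 1)) else 0)"

lemma survival_bounds: "0 \<le> survival P n k \<and> survival P n k \<le> 1"
proof (induction n arbitrary: k)
  case (Suc n)
  have "integrable P (\<lambda>j. survival P n (k + int j - 1))"
    using Suc by (intro measure_pmf.integrable_const_bound[where B = 1]) auto
  then have "measure_pmf.expectation P (\<lambda>j. survival P n (k + int j - 1)) \<le> 1"
    by (rule measure_pmf.integral_le_const) (use Suc in auto)
  then show ?case using Suc by (auto intro!: Bochner_Integration.integral_nonneg)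
qed auto

lemma survival_nonneg: "0 \<le> survival P n k" and survival_le_1: "survival P n k \<le> 1"
  using survival_bounds by auto

lemma survival_neg [simp]: "k < 0 \<Longrightarrow> survival P n k = 0"
  by (cases n) auto

lemma integrable_survival [simp]: "integrable (measure_pmf P) (\<lambda>j. survival P n (g j))"
  using survival_bounds by (intro measure_pmf.integrable_const_bound[where B = 1]) auto

text \<open>The walk has steps \<open>j - 1\<close>, so mean 1 is zero drift, and
  \<open>j = 0\<close> is the only value that moves it down.\<close>

locale critical_law =
  fixes P :: "nat pmf"
  assumes integrable_id: "integrable (measure_pmf P) real"
    and mean_1: "measure_pmf.expectation P real = 1"
    and p0_pos: "0 < pmf P 0"
begin

lemma integrable_exp: "0 \<le> \<theta> \<Longrightarrow> integrable (measure_pmf P) (\<lambda>j. exp (- \<theta> * (real j - 1)))"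
  by (rule measure_pmf.integrable_const_bound[where B = "exp \<theta>"]) (auto simp: algebra_simps)

text \<open>Strict Jensen: exp(-\<theta> x) lies above 1 - \<theta> x, whose mean is 1, with a gap
  \<open>d > 0\<close> at the down-step x = -1, which has positive mass.\<close>

lemma laplace_gt_1:
  assumes "0 < \<theta>"
  shows "1 < measure_pmf.expectation P (\<lambda>j. exp (- \<theta> * (real j - 1)))" (is "1 < ?\<Phi>")
proof -
  define d where "d = exp \<theta> - (1 + \<theta>)"
  have d: "0 < d" 
  proof -
    have "(1 + \<theta> / 2)\<^sup>2 \<le> (exp (\<theta> / 2))\<^sup>2"
      using exp_ge_add_one_self[of "\<theta> / 2"] assms by (intro power_mono) auto
    then have "1 + \<theta> + \<theta>\<^sup>2 / 4 \<le> exp \<theta>"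
      by (simp add: power2_eq_square algebra_simps exp_add[symmetric])
    then show ?thesis using assms zero_less_power[of \<theta> 2] unfolding d_def by linarith
  qed
  have "1 + d * pmf P 0 = measure_pmf.expectation P (\<lambda>j. 1 - \<theta> * (real j - 1) + d * indicator {0} j)"
  proof -
    have i: "integrable P (indicator {0} :: nat \<Rightarrow> real)"
      by (intro measure_pmf.integrable_const_bound[where B = 1]) auto
    have "measure_pmf.expectation P (indicator {0}) = pmf P 0" by (simp add: pmf.rep_eq)
    with i show ?thesis using integrable_id mean_1 by simp
  qed
  also have "\<dots> \<le> ?\<Phi>"
  proof (rule integral_mono)
    have "integrable P (indicator {0} :: nat \<Rightarrow> real)"
      by (intro measure_pmf.integrable_const_bound[where B = 1]) auto
    then show "integrable P (\<lambda>j. 1 - \<theta> * (real j - 1) + d * indicator {0} j)"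
      using integrable_id by simp
    show "integrable P (\<lambda>j. exp (- \<theta> * (real j - 1)))" using assms integrable_exp by simp
    fix j :: nat
    show "1 - \<theta> * (real j - 1) + d * indicator {0} j \<le> exp (- \<theta> * (real j - 1))"
      using exp_ge_add_one_self[of "- \<theta> * (real j - 1)"] by (cases j) (auto simp: d_def algebra_simps)
  qed
  finally show ?thesis using d p0_pos mult_pos_pos[of d "pmf P 0"] by linarith
qed

text \<open>A finite-time form of optional stopping for the martingale \<open>exp (- \<theta> X n) / \<Phi> ^ n\<close>.\<close>

lemma survival_upper:
  assumes \<theta>: "0 < \<theta>" and k: "-1 \<le> k"
  defines "\<Phi> \<equiv> measure_pmf.expectation P (\<lambda>j. exp (- \<theta> * (real j - 1)))"
  shows "exp (- \<theta> * (of_int k + 1)) - (1 / \<Phi>) ^ n \<le> 1 - survival P n k"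
  using k
proof (induction n arbitrary: k)
  case 0
  then have "0 \<le> \<theta> * (of_int k + 1)" using \<theta> by simp
  then have "exp (- \<theta> * (of_int k + 1)) \<le> 1" by simp
  with survival_le_1[of P 0 k] show ?case by (simp only: power_0)
next
  case (Suc n)
  have \<Phi>: "1 < \<Phi>" unfolding \<Phi>_def by (rule laplace_gt_1) fact
  show ?case
  \<comment> \<open>At -1 the walk is dead, and from a nonnegative \<open>k\<close> it reaches at
    least -1, so the induction hypothesis covers all successors.\<close>
  proof (cases "k = -1")
    case True
    then show ?thesis using \<Phi> by simp
  next
    case False
    with Suc.prems have k: "0 \<le> k" by simp
    let ?x = "exp (- \<theta> * (of_int k + 1))"
    have "?x * \<Phi> - (1 / \<Phi>) ^ n =
        measure_pmf.expectation P (\<lambda>j. ?x * exp (- \<theta> * (real j - 1)) - (1 / \<Phi>) ^ n)"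
      using integrable_exp \<theta> unfolding \<Phi>_def by simp
    also have "\<dots> \<le> measure_pmf.expectation P (\<lambda>j. 1 - survival P n (k + int j - 1))"
    proof (rule integral_mono)
      show "integrable P (\<lambda>j. ?x * exp (- \<theta> * (real j - 1)) - (1 / \<Phi>) ^ n)"
        using integrable_exp \<theta> by simp
      fix j
      show "?x * exp (- \<theta> * (real j - 1)) - (1 / \<Phi>) ^ n \<le> 1 - survival P n (k + int j - 1)"
      proof -
        have "?x * exp (- \<theta> * (real j - 1)) = exp (- \<theta> * (of_int (k + int j - 1) + 1))"
          unfolding exp_add[symmetric] by (rule arg_cong[of _ _ exp]) (simp add: algebra_simps)
        with Suc.IH[of "k + int j - 1"] k show ?thesis by simp
      qed
    qed simp
    also have "\<dots> = 1 - survival P (Suc n) k" using k by simp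
    finally have *: "?x * \<Phi> - (1 / \<Phi>) ^ n \<le> 1 - survival P (Suc n) k" .
    show ?thesis
    \<comment> \<open>A nonpositive left-hand side is trivial; otherwise multiplying it by \<Phi> >
      1 only increases it, and the product is the quantity just bounded.\<close>
    proof (cases "?x \<le> (1 / \<Phi>) ^ Suc n")
      case True
      then show ?thesis using survival_le_1[of P "Suc n" k] by linarith
    next
      case False
      then have "(1 / \<Phi>) ^ Suc n * (\<Phi> - 1) \<le> ?x * (\<Phi> - 1)" using \<Phi> by (intro mult_right_mono) auto
      moreover have "(1 / \<Phi>) ^ Suc n * \<Phi> = (1 / \<Phi>) ^ n" using \<Phi> by simp
      ultimately have "?x - (1 / \<Phi>) ^ Suc n \<le> ?x * \<Phi> - (1 / \<Phi>) ^ n" by (simp only: algebra_simps)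
      with * show ?thesis by linarith
    qed
  qed
qed

text \<open>For fixed \<theta> the upper bound on survival tends to 1 - exp(-\<theta> (k + 1)), and
  \<theta> can be taken arbitrarily small.\<close>

lemma survival_tendsto_0: "(\<lambda>n. survival P n k) \<longlonglongrightarrow> 0"
proof (cases "0 \<le> k")
  case True
  show ?thesis
  proof (rule LIMSEQ_I)
    fix r :: real assume r: "0 < r"
    \<comment> \<open>Chosen so that 1 - exp(-\<theta> (k + 1)) is at most r/2.\<close>
    define \<theta> where "\<theta> = r / 2 / (of_int k + 1)"
    have \<theta>: "0 < \<theta>" "\<theta> * (of_int k + 1) = r / 2" using r True by (auto simp: \<theta>_def field_simps)
    define \<Phi> where "\<Phi> = measure_pmf.expectation P (\<lambda>j. exp (- \<theta> * (real j - 1)))"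
    have "1 < \<Phi>" unfolding \<Phi>_def by (rule laplace_gt_1) fact
    then have "(\<lambda>n. (1 / \<Phi>) ^ n) \<longlonglongrightarrow> 0" by (intro LIMSEQ_power_zero) auto
    from LIMSEQ_D[OF this, of "r / 2"] r obtain N where N: "\<And>n. N \<le> n \<Longrightarrow> \<bar>(1 / \<Phi>) ^ n\<bar> < r / 2" by auto
    have "norm (survival P n k - 0) < r" if "N \<le> n" for n
    proof -
      have "1 - r / 2 \<le> exp (- \<theta> * (of_int k + 1))"
        using exp_ge_add_one_self[of "- \<theta> * (of_int k + 1)"] \<theta>(2) by (simp only: mult_minus_left)
      with survival_upper[OF \<theta>(1), of k n] True N[OF that] survival_nonneg[of P n k]
      show ?thesis unfolding \<Phi>_def by simp
    qed
    then show "\<exists>N. \<forall>n\<ge>N. norm (survival P n k - 0) < r" by blast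
  qed
qed simp

end

section \<open>Stopped random walks\<close>

text \<open>The second component lists the times of the visits to \<open>0\<close> before the walk is stopped in \<open>S\<close>.\<close>

definition step :: "int set \<Rightarrow> nat \<Rightarrow> int \<times> nat list \<Rightarrow> nat \<Rightarrow> int \<times> nat list" where
  "step S n w j = (if fst w \<in> S then w
     else (fst w + int j - 1, if fst w = 0 then n # snd w else snd w))"

primrec walk :: "int set \<Rightarrow> (nat \<Rightarrow> nat) \<Rightarrow> nat \<Rightarrow> int \<times> nat list" where
  "walk S j 0 = (0, [])"
| "walk S j (Suc n) = step S n (walk S j n) (j n)"

text \<open>On a path that never enters \<open>S\<close> the chosen index is unspecified; later
  results either discard such paths as a null set or hold for every index.\<close>

definition walk_end :: "int set \<Rightarrow> (nat \<Rightarrow> nat) \<Rightarrow> int \<times> nat list" where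
  "walk_end S j = walk S j (LEAST n. fst (walk S j n) \<in> S)"

lemma walk_cong: "(\<And>i. i < n \<Longrightarrow> j i = j' i) \<Longrightarrow> walk S j n = walk S j' n"
  by (induction n) auto

lemma walk_absorbed: "fst (walk S j n) \<in> S \<Longrightarrow> n \<le> m \<Longrightarrow> walk S j m = walk S j n"
  by (induction m) (auto simp: le_Suc_eq step_def)

lemma walk_end_eq:
  assumes "fst (walk S j n) \<in> S"
  shows "walk_end S j = walk S j n"
proof -
  let ?m = "LEAST n. fst (walk S j n) \<in> S"
  have "fst (walk S j ?m) \<in> S" by (rule LeastI) (rule assms)
  moreover have "?m \<le> n" by (rule Least_le) (rule assms)
  ultimately show ?thesis unfolding walk_end_def by (metis walk_absorbed)
qed

lemma measurable_walk:
  assumes "\<And>i. i < n \<Longrightarrow> f i \<in> N \<rightarrow>\<^sub>M count_space UNIV"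
  shows "(\<lambda>\<omega>. walk S (\<lambda>i. f i \<omega>) n) \<in> N \<rightarrow>\<^sub>M count_space UNIV"
  using assms
proof (induction n)
  case (Suc n)
  have [measurable]: "f n \<in> N \<rightarrow>\<^sub>M count_space UNIV" using Suc.prems by simp
  have [measurable]: "(\<lambda>\<omega>. walk S (\<lambda>i. f i \<omega>) n) \<in> N \<rightarrow>\<^sub>M count_space UNIV"
    by (rule Suc.IH) (use Suc.prems in simp)
  show ?case unfolding walk.simps by measurable
qed simp

lemma measurable_walk_end:
  assumes f: "\<And>i. f i \<in> N \<rightarrow>\<^sub>M count_space UNIV"
  shows "(\<lambda>\<omega>. walk_end S (\<lambda>i. f i \<omega>)) \<in> N \<rightarrow>\<^sub>M count_space UNIV"
proof -
  note [measurable] = measurable_walk[OF f]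
  show ?thesis unfolding walk_end_def
    by (rule measurable_compose_countable[where f = "\<lambda>n \<omega>. walk S (\<lambda>i. f i \<omega>) n"]) measurable
qed

context critical_law
begin

lemma expectation_if_0:
  "measure_pmf.expectation P (\<lambda>j. if j = 0 then a else b) = a * pmf P 0 + b * (1 - pmf P 0)"
proof -
  have i: "integrable P (indicator {0} :: nat \<Rightarrow> real)"
    by (intro measure_pmf.integrable_const_bound[where B = 1]) auto
  have "measure_pmf.expectation P (\<lambda>j. if j = 0 then a else b) =
      measure_pmf.expectation P (\<lambda>j. b + (a - b) * indicator {0} j)"
    by (intro Bochner_Integration.integral_cong) auto
  also have "\<dots> = b + (a - b) * pmf P 0"
    using i by (simp add: pmf.rep_eq)
  finally show ?thesis by (simp add: algebra_simps)
qed

lemma integrable_up: "integrable P (\<lambda>j. real (j - 1))"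
  by (rule Bochner_Integration.integrable_bound[OF integrable_id]) auto

text \<open>Truncated subtraction makes \<open>real (j - 1)\<close> the upward part of the step.
  With zero drift it has the same mean as the downward part, which is the probability of a
  down-step.\<close>

lemma expectation_up: "measure_pmf.expectation P (\<lambda>j. real (j - 1)) = pmf P 0"
proof -
  have i: "integrable P (\<lambda>j. if j = 0 then 1 else 0 :: real)"
    by (intro measure_pmf.integrable_const_bound[where B = 1]) auto
  have "(\<lambda>j. real (j - 1)) = (\<lambda>j. real j - 1 + (if j = 0 then 1 else 0))"
    by (auto simp: fun_eq_iff)
  then have "measure_pmf.expectation P (\<lambda>j. real (j - 1)) =
      measure_pmf.expectation P (\<lambda>j. real j - 1 + (if j = 0 then 1 else 0))" by simp
  also have "\<dots> = pmf P 0" using i integrable_id mean_1 expectation_if_0[of 1 0] by simp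
  finally show ?thesis .
qed

end

section \<open>Laws along the stopped walk\<close>

locale stopped_walk = prob_space M + critical_law P
  for M :: "'w measure" and P :: "nat pmf" +
  fixes J :: "nat \<Rightarrow> 'w \<Rightarrow> nat" and S :: "int set"
  assumes indep_J: "indep_vars (\<lambda>_. count_space UNIV) J UNIV"
    and law_J: "distr M (count_space UNIV) (J n) = measure_pmf P"
begin

abbreviation "W n \<omega> \<equiv> walk S (\<lambda>i. J i \<omega>) n"
abbreviation "W_end \<omega> \<equiv> walk_end S (\<lambda>i. J i \<omega>)"

lemma J_measurable [measurable]: "J n \<in> M \<rightarrow>\<^sub>M count_space UNIV"
  using indep_J by (simp add: indep_vars_def)

lemma W_measurable [measurable]: "W n \<in> M \<rightarrow>\<^sub>M count_space UNIV"
  by (rule measurable_walk) measurable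

lemma W_end_measurable [measurable]: "W_end \<in> M \<rightarrow>\<^sub>M count_space UNIV"
  by (rule measurable_walk_end) measurable

text \<open>\<open>W n\<close> depends only on the steps before \<open>n\<close> and is therefore
  independent of \<open>J n\<close>. Both orders of integration are recorded: one gives the Markov
  property, the other the last-step decomposition.\<close>

lemma expectation_W_J:
  fixes g :: "int \<times> nat list \<Rightarrow> nat \<Rightarrow> real"
  assumes bound: "\<And>w j. \<bar>g w j\<bar> \<le> B"
  shows "expectation (\<lambda>\<omega>. g (W n \<omega>) (J n \<omega>)) = expectation (\<lambda>\<omega>. measure_pmf.expectation P (g (W n \<omega>)))"
    and "expectation (\<lambda>\<omega>. g (W n \<omega>) (J n \<omega>)) = measure_pmf.expectation P (\<lambda>j. expectation (\<lambda>\<omega>. g (W n \<omega>) j))"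
proof -
  let ?C = "count_space UNIV :: nat measure"
  let ?A = "PiM {..<n} (\<lambda>_. ?C)" and ?B = "PiM {n} (\<lambda>_. ?C)"
  let ?past = "\<lambda>\<omega>. restrict (\<lambda>i. J i \<omega>) {..<n}" and ?now = "\<lambda>\<omega>. restrict (\<lambda>i. J i \<omega>) {n}"
  let ?g = "\<lambda>(a, b). g (walk S a n) (b n)"
  have indep: "indep_var ?A ?past ?B ?now"
    by (rule indep_var_restrict[OF indep_J]) auto
  have past [measurable]: "?past \<in> M \<rightarrow>\<^sub>M ?A" and now [measurable]: "?now \<in> M \<rightarrow>\<^sub>M ?B"
    using indep_var_rv1[OF indep] indep_var_rv2[OF indep] by auto
  have walk_past: "walk S (?past \<omega>) n = W n \<omega>" for \<omega>
    by (rule walk_cong) simp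
  interpret PA: prob_space "distr M ?A ?past" by (rule prob_space_distr) fact
  interpret PB: prob_space "distr M ?B ?now" by (rule prob_space_distr) fact
  interpret AB: pair_prob_space "distr M ?A ?past" "distr M ?B ?now" ..
  have walk_meas: "(\<lambda>a. walk S (\<lambda>i. a i) n) \<in> ?A \<rightarrow>\<^sub>M count_space UNIV"
    by (rule measurable_walk) (auto intro: measurable_component_singleton)
  then have wm [measurable]: "(\<lambda>a. walk S a n) \<in> ?A \<rightarrow>\<^sub>M count_space UNIV" by simp
  have bn [measurable]: "(\<lambda>b. b n) \<in> ?B \<rightarrow>\<^sub>M ?C"
    by (rule measurable_component_singleton) simp
  \<comment> \<open>Joint measurability is obtained by splitting over the countably many values of
    the last step.\<close>
  have "(\<lambda>x. g (walk S (fst x) n) (snd x n)) \<in> borel_measurable (?A \<Otimes>\<^sub>M ?B)"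
  proof (rule measurable_compose_countable[where f = "\<lambda>j x. g (walk S (fst x) n) j"])
    fix j
    show "(\<lambda>x. g (walk S (fst x) n) j) \<in> borel_measurable (?A \<Otimes>\<^sub>M ?B)"
      by (rule measurable_compose[of "\<lambda>x. walk S (fst x) n" _ "count_space UNIV"]) measurable
  qed measurable
  then have g_AB [measurable]: "?g \<in> borel_measurable (?A \<Otimes>\<^sub>M ?B)" by (simp add: case_prod_beta)
  have int: "integrable (distr M ?A ?past \<Otimes>\<^sub>M distr M ?B ?now) ?g"
  proof (rule AB.P.integrable_const_bound[of _ B])
    show "?g \<in> borel_measurable (distr M ?A ?past \<Otimes>\<^sub>M distr M ?B ?now)" by simp
    show "AE x in distr M ?A ?past \<Otimes>\<^sub>M distr M ?B ?now. norm (?g x) \<le> B"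
      using bound by (auto intro!: AE_I2 simp: case_prod_beta)
  qed
  have "expectation (\<lambda>\<omega>. g (W n \<omega>) (J n \<omega>)) =
      integral\<^sup>L (distr M (?A \<Otimes>\<^sub>M ?B) (\<lambda>\<omega>. (?past \<omega>, ?now \<omega>))) ?g"
    using g_AB walk_past by (subst integral_distr) auto
  also have "distr M (?A \<Otimes>\<^sub>M ?B) (\<lambda>\<omega>. (?past \<omega>, ?now \<omega>)) = distr M ?A ?past \<Otimes>\<^sub>M distr M ?B ?now"
    using indep unfolding indep_var_distribution_eq by simp
  finally have *: "expectation (\<lambda>\<omega>. g (W n \<omega>) (J n \<omega>)) =
      integral\<^sup>L (distr M ?A ?past \<Otimes>\<^sub>M distr M ?B ?now) ?g" .
  have inner1: "(\<integral>b. g w (b n) \<partial>distr M ?B ?now) = measure_pmf.expectation P (g w)" for w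
  proof -
    have "(\<integral>b. g w (b n) \<partial>distr M ?B ?now) = expectation (\<lambda>\<omega>. g w (J n \<omega>))"
      by (subst integral_distr) (auto intro: measurable_compose[OF bn])
    also have "\<dots> = integral\<^sup>L (distr M ?C (J n)) (g w)" by (subst integral_distr) auto
    finally show ?thesis by (simp add: law_J)
  qed
  have inner2: "(\<integral>a. g (walk S a n) j \<partial>distr M ?A ?past) = expectation (\<lambda>\<omega>. g (W n \<omega>) j)" for j
    by (subst integral_distr) (auto simp: walk_past intro: measurable_compose[OF wm])
  show "expectation (\<lambda>\<omega>. g (W n \<omega>) (J n \<omega>)) = expectation (\<lambda>\<omega>. measure_pmf.expectation P (g (W n \<omega>)))"
    unfolding * AB.integral_fst'[OF int, symmetric] case_prod_conv inner1
    by (subst integral_distr) (auto simp: walk_past intro: measurable_compose[OF wm])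
  have "integral\<^sup>L (distr M ?A ?past \<Otimes>\<^sub>M distr M ?B ?now) ?g =
      (\<integral>b. expectation (\<lambda>\<omega>. g (W n \<omega>) (b n)) \<partial>distr M ?B ?now)"
    using AB.integral_snd[of "\<lambda>a b. g (walk S a n) (b n)"] int inner2 by simp
  also have "\<dots> = expectation (\<lambda>\<omega>'. expectation (\<lambda>\<omega>. g (W n \<omega>) (J n \<omega>')))"
    by (subst integral_distr) (auto intro: measurable_compose[OF bn])
  also have "\<dots> = integral\<^sup>L (distr M ?C (J n)) (\<lambda>j. expectation (\<lambda>\<omega>. g (W n \<omega>) j))"
    by (subst integral_distr) auto
  finally show "expectation (\<lambda>\<omega>. g (W n \<omega>) (J n \<omega>)) = measure_pmf.expectation P (\<lambda>j. expectation (\<lambda>\<omega>. g (W n \<omega>) j))"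
    unfolding * law_J .
qed

lemma expectation_W_Suc:
  assumes "\<And>w. \<bar>F w :: real\<bar> \<le> B"
  shows "expectation (\<lambda>\<omega>. F (W (Suc n) \<omega>)) =
    expectation (\<lambda>\<omega>. measure_pmf.expectation P (\<lambda>j. F (step S n (W n \<omega>) j)))"
  using expectation_W_J(1)[of "\<lambda>w j. F (step S n w j)" B n] assms by simp

lemma prob_eq_expectation:
  assumes "{\<omega> \<in> space M. R \<omega>} \<in> events"
  shows "prob {\<omega> \<in> space M. R \<omega>} = expectation (\<lambda>\<omega>. if R \<omega> then 1 else 0)"
proof -
  have "expectation (\<lambda>\<omega>. if R \<omega> then 1 else 0) = expectation (indicator {\<omega> \<in> space M. R \<omega>})"
    by (rule Bochner_Integration.integral_cong) (auto simp: indicator_def)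
  also have "\<dots> = prob {\<omega> \<in> space M. R \<omega>}"
    using assms sets.sets_into_space[OF assms] by (simp add: Int_absorb2)
  finally show ?thesis ..
qed

lemma prob_W_expectation:
  "prob {\<omega> \<in> space M. U (W n \<omega>)} = expectation (\<lambda>\<omega>. if U (W n \<omega>) then 1 else 0)"
  using measurable_sets[OF W_measurable, of "{w. U w}" n]
  by (intro prob_eq_expectation) (simp add: vimage_def Int_def conj_commute)

lemma prob_W_J:
  "prob {\<omega> \<in> space M. Q (W n \<omega>) (J n \<omega>)} =
    measure_pmf.expectation P (\<lambda>j. prob {\<omega> \<in> space M. Q (W n \<omega>) j})"
proof -
  have [measurable]: "(\<lambda>\<omega>. Q (W n \<omega>) (J n \<omega>)) \<in> M \<rightarrow>\<^sub>M count_space UNIV"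
    by (rule measurable_compose_countable[where g = "J n" and f = "\<lambda>j \<omega>. Q (W n \<omega>) j"]) measurable
  have "prob {\<omega> \<in> space M. Q (W n \<omega>) (J n \<omega>)} =
      expectation (\<lambda>\<omega>. if Q (W n \<omega>) (J n \<omega>) then 1 else 0)"
    by (rule prob_eq_expectation) measurable
  also have "\<dots> = measure_pmf.expectation P (\<lambda>j. expectation (\<lambda>\<omega>. if Q (W n \<omega>) j then 1 else 0))"
    by (rule expectation_W_J(2)[of "\<lambda>w j. if Q w j then 1 else 0" 1]) auto
  also have "\<dots> = measure_pmf.expectation P (\<lambda>j. prob {\<omega> \<in> space M. Q (W n \<omega>) j})"
    by (intro Bochner_Integration.integral_cong refl prob_eq_expectation[symmetric]) measurable
  finally show ?thesis .
qed

text \<open>The stopped walk stays put after entering \<open>S\<close>, so the events increase with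
  \<open>n\<close>.\<close>

lemma AE_stoppedI:
  assumes "(\<lambda>n. prob {\<omega> \<in> space M. fst (W n \<omega>) \<in> S}) \<longlonglongrightarrow> 1"
  shows "AE \<omega> in M. \<exists>n. fst (W n \<omega>) \<in> S"
proof -
  let ?A = "\<lambda>n. {\<omega> \<in> space M. fst (W n \<omega>) \<in> S}"
  have "incseq ?A" by (auto simp: incseq_def) (metis walk_absorbed)+
  then have "(\<lambda>n. prob (?A n)) \<longlonglongrightarrow> prob (\<Union>n. ?A n)"
    by (intro finite_Lim_measure_incseq) auto
  with assms have "prob (\<Union>n. ?A n) = 1" by (rule LIMSEQ_unique[symmetric])
  then have "AE \<omega> in M. \<omega> \<in> (\<Union>n. ?A n)" by (subst (asm) prob_eq_1) auto
  then show ?thesis by eventually_elim auto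
qed

text \<open>By the same monotonicity the events increase, and up to a null set their union is the
  event for \<open>W_end\<close>.\<close>

lemma prob_W_end_limit:
  assumes stopped: "AE \<omega> in M. \<exists>n. fst (W n \<omega>) \<in> S"
  shows "(\<lambda>n. prob {\<omega> \<in> space M. fst (W n \<omega>) \<in> S \<and> Q (W n \<omega>)}) \<longlonglongrightarrow>
    prob {\<omega> \<in> space M. Q (W_end \<omega>)}"
proof -
  let ?A = "\<lambda>n. {\<omega> \<in> space M. fst (W n \<omega>) \<in> S \<and> Q (W n \<omega>)}"
  have "incseq ?A" by (auto simp: incseq_def) (metis walk_absorbed)+
  then have "(\<lambda>n. prob (?A n)) \<longlonglongrightarrow> prob (\<Union>n. ?A n)"
    by (intro finite_Lim_measure_incseq) auto
  also have "prob (\<Union>n. ?A n) = prob {\<omega> \<in> space M. Q (W_end \<omega>)}"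
  proof (rule measure_eq_AE)
    show "AE \<omega> in M. \<omega> \<in> (\<Union>n. ?A n) \<longleftrightarrow> \<omega> \<in> {\<omega> \<in> space M. Q (W_end \<omega>)}"
      using stopped by eventually_elim (auto simp: walk_end_eq, metis walk_end_eq)
  qed auto
  finally show ?thesis .
qed

lemma integrable_W:
  fixes F :: "int \<times> nat list \<Rightarrow> real"
  assumes "\<And>w. \<bar>F w\<bar> \<le> B"
  shows "integrable M (\<lambda>\<omega>. F (W n \<omega>))"
  by (rule integrable_const_bound[where B = B])
     (use assms in \<open>auto intro: measurable_compose[OF W_measurable]\<close>)

end

section \<open>First passage below and above the start\<close>

locale down_walk = stopped_walk M P J "{..<0}" for M :: "'w measure" and P J
begin

text \<open>\<open>m\<close> counts steps still to come and \<open>n\<close> steps already made;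
  each use of the Markov property moves one step from the second to the first.\<close>

lemma expectation_survival:
  "expectation (\<lambda>\<omega>. survival P m (fst (W n \<omega>))) = survival P (m + n) 0"
proof (induction n arbitrary: m)
  case 0
  then show ?case by (simp add: prob_space)
next
  case (Suc n)
  have "measure_pmf.expectation P (\<lambda>j. survival P m (fst (step {..<0} n w j))) = survival P (Suc m) (fst w)" for w
    by (cases "0 \<le> fst w") (simp_all add: step_def)
  then have "expectation (\<lambda>\<omega>. survival P m (fst (W (Suc n) \<omega>))) = expectation (\<lambda>\<omega>. survival P (Suc m) (fst (W n \<omega>)))"
    using survival_bounds by (subst expectation_W_Suc[where B = 1 and F = "\<lambda>w. survival P m (fst w)"]) auto
  with Suc.IH[of "Suc m"] show ?case by simp
qed

lemma prob_alive: "prob {\<omega> \<in> space M. 0 \<le> fst (W n \<omega>)} = survival P n 0"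
  using expectation_survival[of 0 n] prob_W_expectation[of "\<lambda>w. 0 \<le> fst w" n] by simp

lemma AE_stopped: "AE \<omega> in M. \<exists>n. fst (W n \<omega>) \<in> {..<0}"
proof (rule AE_stoppedI)
  have "prob {\<omega> \<in> space M. fst (W n \<omega>) \<in> {..<0}} = 1 - survival P n 0" for n
  proof -
    have [measurable]: "(\<lambda>\<omega>. 0 \<le> fst (W n \<omega>)) \<in> M \<rightarrow>\<^sub>M count_space UNIV"
      by (rule measurable_compose[OF W_measurable]) simp
    have "prob {\<omega> \<in> space M. \<not> 0 \<le> fst (W n \<omega>)} = 1 - prob {\<omega> \<in> space M. 0 \<le> fst (W n \<omega>)}"
      by (rule prob_neg) measurable
    then show ?thesis by (simp add: prob_alive not_le)
  qed
  then show "(\<lambda>n. prob {\<omega> \<in> space M. fst (W n \<omega>) \<in> {..<0}}) \<longlonglongrightarrow> 1"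
    using tendsto_diff[OF tendsto_const survival_tendsto_0, of 1 0] by simp
qed

text \<open>The conditional probability that the final number of visits is \<open>c\<close>, given the current state; it
  is a bounded martingale along the walk.\<close>

definition count_prob :: "nat \<Rightarrow> int \<times> nat list \<Rightarrow> real" where
  "count_prob c w = (if fst w < 0 then (if length (snd w) = c then 1 else 0)
     else if length (snd w) < c then (1 - pmf P 0) ^ (c - length (snd w) - 1) * pmf P 0 else 0)"

lemma count_prob_bounds: "0 \<le> count_prob c w" "count_prob c w \<le> 1"
  by (auto simp: count_prob_def pmf_le_1 intro!: mult_le_one power_le_one)

text \<open>The value ignores the position as long as it is nonnegative. Only a step from 0 matters:
  a visit is recorded, and with probability \<open>pmf P 0\<close> the walk stops at once.\<close>

lemma count_prob_step:
  "measure_pmf.expectation P (\<lambda>j. count_prob c (step {..<0} n w j)) = count_prob c w"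
proof -
  consider "fst w < 0" | "fst w = 0" | "0 < fst w" by linarith
  then show ?thesis
  proof cases
    case 2
    let ?l = "length (snd w)"
    have "(\<lambda>j. count_prob c (step {..<0} n w j)) =
        (\<lambda>j. if j = 0 then (if Suc ?l = c then 1 else 0)
          else (if Suc ?l < c then (1 - pmf P 0) ^ (c - Suc ?l - 1) * pmf P 0 else 0))"
      using 2 by (auto simp: fun_eq_iff step_def count_prob_def)
    then have "measure_pmf.expectation P (\<lambda>j. count_prob c (step {..<0} n w j)) =
        (if Suc ?l = c then 1 else 0) * pmf P 0 +
        (if Suc ?l < c then (1 - pmf P 0) ^ (c - Suc ?l - 1) * pmf P 0 else 0) * (1 - pmf P 0)"
      by (simp only: expectation_if_0)
    also have "\<dots> = count_prob c w"
    proof -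
      consider "c \<le> ?l" | "c = Suc ?l" | d where "c = Suc (Suc (?l + d))"
        by (metis add_Suc_right le_Suc_eq le_add_diff_inverse2 add.commute not_less_eq_eq)
      then show ?thesis by cases (use 2 in \<open>auto simp: count_prob_def\<close>)
    qed
    finally show ?thesis .
  qed (auto simp: step_def count_prob_def)
qed

lemma expectation_count_prob:
  "expectation (\<lambda>\<omega>. count_prob c (W n \<omega>)) = count_prob c (0, [])"
proof (induction n)
  case (Suc n)
  then show ?case
    using count_prob_bounds[of c] by (subst expectation_W_Suc[where B = 1]) (auto simp: count_prob_step)
qed (simp add: prob_space)

text \<open>The martingale lies between the indicator of being stopped with \<open>c\<close> visits
  and the sum of this indicator and that of survival, whose mean tends to 0.\<close>

lemma prob_visits:
  assumes "1 \<le> c"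
  shows "prob {\<omega> \<in> space M. length (snd (W_end \<omega>)) = c} = (1 - pmf P 0) ^ (c - 1) * pmf P 0"
proof -
  let ?p = "\<lambda>n. prob {\<omega> \<in> space M. fst (W n \<omega>) \<in> {..<0} \<and> length (snd (W n \<omega>)) = c}"
  let ?q = "count_prob c (0, [])"
  have q: "?q = (1 - pmf P 0) ^ (c - 1) * pmf P 0"
    using assms by (simp add: count_prob_def)
  have bounds: "?q - survival P n 0 \<le> ?p n \<and> ?p n \<le> ?q" for n
  proof -
    let ?i = "\<lambda>w. if fst w \<in> {..<0} \<and> length (snd w) = c then 1 else 0 :: real"
    let ?a = "\<lambda>w. if 0 \<le> fst w then 1 else 0 :: real"
    have int: "integrable M (\<lambda>\<omega>. count_prob c (W n \<omega>))" "integrable M (\<lambda>\<omega>. ?i (W n \<omega>))"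
        "integrable M (\<lambda>\<omega>. ?a (W n \<omega>))"
      using count_prob_bounds[of c] by (auto intro!: integrable_W[where B = 1])
    have p: "?p n = expectation (\<lambda>\<omega>. ?i (W n \<omega>))"
      by (rule prob_W_expectation[of "\<lambda>w. fst w \<in> {..<0} \<and> length (snd w) = c" n])
    have a: "survival P n 0 = expectation (\<lambda>\<omega>. ?a (W n \<omega>))"
      unfolding prob_alive[symmetric] by (rule prob_W_expectation[of "\<lambda>w. 0 \<le> fst w" n])
    have "?i w \<le> count_prob c w" "count_prob c w \<le> ?i w + ?a w" for w
      using count_prob_bounds[of c w] by (auto simp: count_prob_def split: if_splits)
    then have "expectation (\<lambda>\<omega>. ?i (W n \<omega>)) \<le> expectation (\<lambda>\<omega>. count_prob c (W n \<omega>))"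
      "expectation (\<lambda>\<omega>. count_prob c (W n \<omega>)) \<le> expectation (\<lambda>\<omega>. ?i (W n \<omega>) + ?a (W n \<omega>))"
      by (intro integral_mono Bochner_Integration.integrable_add int; blast)+
    then show ?thesis using int unfolding p a expectation_count_prob by simp
  qed
  have "?p \<longlonglongrightarrow> ?q"
  proof (rule tendsto_sandwich)
    show "(\<lambda>n. ?q - survival P n 0) \<longlonglongrightarrow> ?q"
      using tendsto_diff[OF tendsto_const survival_tendsto_0, of ?q 0] by simp
  qed (use bounds in auto)
  with prob_W_end_limit[OF AE_stopped, of "\<lambda>w. length (snd w) = c"] show ?thesis
    unfolding q[symmetric] by (rule LIMSEQ_unique)
qed

text \<open>Steps are at least -1, so the passage below 0 cannot overshoot.\<close>

lemma AE_W_end: "AE \<omega> in M. fst (W_end \<omega>) = -1"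
  using AE_stopped
proof eventually_elim
  fix \<omega> assume "\<exists>n. fst (W n \<omega>) \<in> {..<0}"
  then obtain n where n: "fst (W n \<omega>) \<in> {..<0}" by blast
  have "-1 \<le> fst (W n \<omega>)" by (induction n) (auto simp: step_def)
  with n show "fst (W_end \<omega>) = -1" by (simp add: walk_end_eq)
qed

end

section \<open>First passage above the start\<close>

locale up_walk = stopped_walk M P J "{1..}" for M :: "'w measure" and P J
begin

text \<open>The position \<open>- i\<close> at time \<open>n\<close>, with the number of visits to \<open>0\<close> up to and including time \<open>n\<close>
  restricted by \<open>R\<close>. The list in the state only counts the visits before time \<open>n\<close>, hence the
  correction at \<open>i = 0\<close>.\<close>

definition visit :: "(nat \<Rightarrow> bool) \<Rightarrow> nat \<Rightarrow> int \<Rightarrow> real" where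
  "visit R n i = (if 0 \<le> i
     then prob {\<omega> \<in> space M. fst (W n \<omega>) = - i \<and> R (length (snd (W n \<omega>)) + (if i = 0 then 1 else 0))}
     else 0)"

text \<open>The Green function of the walk killed above 0, truncated at time
  \<open>n\<close>.\<close>

definition green :: "(nat \<Rightarrow> bool) \<Rightarrow> nat \<Rightarrow> int \<Rightarrow> real" where
  "green R n i = (\<Sum>m<n. visit R m i)"

lemma visit_bounds: "0 \<le> visit R n i" "visit R n i \<le> 1"
  by (auto simp: visit_def)

lemma green_bounds: "0 \<le> green R n i" "green R n i \<le> real n"
  unfolding green_def using visit_bounds sum_bounded_above[of "{..<n}" "\<lambda>m. visit R m i" 1]
  by (auto intro: sum_nonneg)

lemma green_neg [simp]: "i < 0 \<Longrightarrow> green R n i = 0"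
  by (simp add: green_def visit_def)

lemma integrable_visit [simp]: "integrable (measure_pmf P) (\<lambda>j. visit R n (f j))"
  using visit_bounds by (intro measure_pmf.integrable_const_bound[where B = 1]) auto

lemma integrable_green [simp]: "integrable (measure_pmf P) (\<lambda>j. green R n (f j))"
  using green_bounds by (intro measure_pmf.integrable_const_bound[where B = "real n"]) auto

text \<open>Undoing a step \<open>j - 1\<close> leads from \<open>- i\<close> to
  \<open>- (i + j - 1)\<close>, so in the coordinate \<open>i\<close> the reversed walk has the same
  step law. For negative \<open>i + j - 1\<close> this predecessor lies in the stopping set and
  contributes 0. A visit at the present time is moved from the count into \<open>R\<close>.\<close>

lemma visit_Suc:
  assumes "0 \<le> i"
  shows "visit R (Suc n) i =
    measure_pmf.expectation P (\<lambda>j. visit (\<lambda>c. R (c + (if i = 0 then 1 else 0))) n (i + int j - 1))"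
proof -
  let ?Q = "\<lambda>w j. fst (step {1..} n w j) = - i \<and>
    R (length (snd (step {1..} n w j)) + (if i = 0 then 1 else 0))"
  have "visit R (Suc n) i = prob {\<omega> \<in> space M. ?Q (W n \<omega>) (J n \<omega>)}"
    using assms by (simp add: visit_def)
  also have "\<dots> = measure_pmf.expectation P (\<lambda>j. prob {\<omega> \<in> space M. ?Q (W n \<omega>) j})"
    by (rule prob_W_J)
  also have "\<dots> = measure_pmf.expectation P (\<lambda>j. visit (\<lambda>c. R (c + (if i = 0 then 1 else 0))) n (i + int j - 1))"
  proof (rule Bochner_Integration.integral_cong[OF refl])
    fix j
    let ?k = "i + int j - 1"
    have "?Q w j \<longleftrightarrow> 0 \<le> ?k \<and> fst w = - ?k \<and>
        R (length (snd w) + (if ?k = 0 then 1 else 0) + (if i = 0 then 1 else 0))" for w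
      using assms by (cases "fst w \<in> {1..}") (auto simp: step_def algebra_simps)
    then show "prob {\<omega> \<in> space M. ?Q (W n \<omega>) j} = visit (\<lambda>c. R (c + (if i = 0 then 1 else 0))) n ?k"
      by (simp add: visit_def)
  qed
  finally show ?thesis .
qed

lemma visit_0: "visit R 0 i = (if i = 0 \<and> R 1 then 1 else 0)"
  by (auto simp: visit_def prob_space)

lemma green_Suc:
  assumes "0 \<le> i"
  shows "green R (Suc n) i = (if i = 0 \<and> R 1 then 1 else 0) +
    measure_pmf.expectation P (\<lambda>j. green (\<lambda>c. R (c + (if i = 0 then 1 else 0))) n (i + int j - 1))"
proof -
  have "green R (Suc n) i = visit R 0 i + (\<Sum>m<n. visit R (Suc m) i)"
    unfolding green_def by (rule sum.lessThan_Suc_shift)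
  also have "(\<Sum>m<n. visit R (Suc m) i) =
      measure_pmf.expectation P (\<lambda>j. green (\<lambda>c. R (c + (if i = 0 then 1 else 0))) n (i + int j - 1))"
    unfolding green_def visit_Suc[OF assms] by (subst Bochner_Integration.integral_sum) auto
  finally show ?thesis by (simp add: visit_0)
qed

text \<open>The constant \<open>1 / p\<close> solves the recursion of the Green function, and the error of the
  truncation solves the recursion of \<^const>\<open>survival\<close>.\<close>

lemma green_True: "0 \<le> i \<Longrightarrow> green (\<lambda>_. True) n i = (1 - survival P n i) / pmf P 0"
proof (induction n arbitrary: i)
  case 0
  then show ?case by (simp add: green_def)
next
  case (Suc n)
  let ?z = "if i = 0 then 1 else 0 :: real"
  \<comment> \<open>For \<open>i = 0\<close> and \<open>j = 0\<close> the predecessor is a stopped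
    position, which \<open>?z\<close> accounts for. The amount \<open>?z * pmf P 0\<close> missing
    in the mean is restored, after division by \<open>pmf P 0\<close>, by the source term of
    \<open>green_Suc\<close>.\<close>
  have "green (\<lambda>_. True) n (i + int j - 1) =
      ((if j = 0 then 1 - ?z else 1) - survival P n (i + int j - 1)) / pmf P 0" for j
    using Suc.IH[of "i + int j - 1"] Suc.prems by (cases "0 \<le> i + int j - 1") auto
  moreover have "integrable P (\<lambda>j. if j = 0 then 1 - ?z else 1)"
    by (intro measure_pmf.integrable_const_bound[where B = 1]) auto
  ultimately have "measure_pmf.expectation P (\<lambda>j. green (\<lambda>_. True) n (i + int j - 1)) =
      (measure_pmf.expectation P (\<lambda>j. if j = 0 then 1 - ?z else 1) - survival P (Suc n) i) / pmf P 0"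
    using Suc.prems by simp
  then show ?case
    using green_Suc[OF Suc.prems, of "\<lambda>_. True" n] p0_pos expectation_if_0[of "1 - ?z" 1]
    by (simp add: field_simps)
qed

text \<open>In the reversed recursion each further visit to 0 costs a factor
  \<open>1 - pmf P 0\<close>, since \<open>j = 0\<close> leads from 0 to -1, where the Green
  function vanishes.\<close>

lemma green_count:
  "green (\<lambda>k. k = c) n i \<le> (if c = 0 then 0 else (1 - pmf P 0) ^ (c - 1))"
proof (induction n arbitrary: c i)
  case 0
  then show ?case by (simp add: green_def pmf_le_1)
next
  case (Suc n)
  show ?case
  proof (cases "0 \<le> i")
    case i: True
    show ?thesis
    proof (cases "i = 0")
      case False
      then have "green (\<lambda>k. k = c) (Suc n) i =
          measure_pmf.expectation P (\<lambda>j. green (\<lambda>k. k = c) n (i + int j - 1))"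
        using green_Suc[OF i, of "\<lambda>k. k = c" n] by simp
      also have "\<dots> \<le> (if c = 0 then 0 else (1 - pmf P 0) ^ (c - 1))"
        by (rule measure_pmf.integral_le_const) (use Suc.IH in auto)
      finally show ?thesis .
    next
      case True
      \<comment> \<open>A visit at 0 counts itself, so \<open>c = 0\<close> is impossible there;
        \<open>c = 1\<close> would leave count 0 to all earlier times, which the induction
        hypothesis excludes, so only the source term remains.\<close>
      consider "c = 0" | "c = 1" | d where "c = Suc (Suc d)"
        by (metis One_nat_def not0_implies_Suc)
      then show ?thesis
      proof cases
        case 1
        have "visit (\<lambda>_. False) m k = 0" for m k by (simp add: visit_def)
        then have "green (\<lambda>_. False) n k = 0" for k by (simp add: green_def)
        then show ?thesis using green_Suc[OF i, of "\<lambda>k. k = c" n] True 1 by simp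
      next
        case 2
        have "green (\<lambda>k. k = 0) n (int j - 1) = 0" for j
          using Suc.IH[of 0 "int j - 1"] green_bounds(1)[of "\<lambda>k. k = 0" n "int j - 1"] by simp
        then show ?thesis using green_Suc[OF i, of "\<lambda>k. k = c" n] True 2 by simp
      next
        case 3
        have "green (\<lambda>k. k = c) (Suc n) i =
            measure_pmf.expectation P (\<lambda>j. green (\<lambda>k. k = Suc d) n (int j - 1))"
          using green_Suc[OF i, of "\<lambda>k. k = c" n] True 3 by simp
        also have "\<dots> \<le> measure_pmf.expectation P (\<lambda>j. if j = 0 then 0 else (1 - pmf P 0) ^ d)"
        proof (rule integral_mono)
          show "integrable P (\<lambda>j. if j = 0 then 0 else (1 - pmf P 0) ^ d)"
            using power_le_one[of "1 - pmf P 0" d]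
            by (intro measure_pmf.integrable_const_bound[where B = 1]) (auto simp: pmf_le_1)
          fix j
          show "green (\<lambda>k. k = Suc d) n (int j - 1) \<le> (if j = 0 then 0 else (1 - pmf P 0) ^ d)"
            using Suc.IH[of "Suc d" "int j - 1"] by simp
        qed simp
        also have "\<dots> = (1 - pmf P 0) ^ (c - 1)" using 3 expectation_if_0[of 0] by simp
        finally show ?thesis using 3 by simp
      qed
    qed
  qed (simp add: pmf_le_1)
qed

text \<open>The step \<open>j - 1\<close> carries \<open>- i\<close> into \<open>{1..}\<close>
  exactly for i = 0, ..., j - 2, that is from \<open>j - 1\<close> positions, and from none if
  \<open>j = 0\<close>.\<close>

lemma sum_const_up: "(\<Sum>i=0..int j - 2. b) = (b :: real) * real (j - 1)"
  by (cases j) auto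

lemma integrable_sum_up:
  assumes "\<And>i. \<bar>F i\<bar> \<le> (B :: real)"
  shows "integrable P (\<lambda>j. \<Sum>i=0..int j - 2. F i)"
proof (rule Bochner_Integration.integrable_bound)
  show "integrable P (\<lambda>j. B * real (j - 1))" using integrable_up by simp
  have "0 \<le> B" using assms[of 0] by linarith
  have "\<bar>\<Sum>i=0..int j - 2. F i\<bar> \<le> B * real (j - 1)" for j
  proof -
    have "\<bar>\<Sum>i=0..int j - 2. F i\<bar> \<le> (\<Sum>i=0..int j - 2. B)"
      using assms by (intro order_trans[OF sum_abs sum_mono]) auto
    also have "\<dots> = B * real (j - 1)" by (rule sum_const_up)
    finally show ?thesis .
  qed
  then show "AE j in P. norm (\<Sum>i=0..int j - 2. F i) \<le> norm (B * real (j - 1))"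
    using \<open>0 \<le> B\<close> by (simp add: abs_mult)
qed simp

text \<open>Decomposes by the position \<open>- i\<close> just before the exit and the step
  \<open>j - 1\<close> made there; summing over the exit time produces the Green function.\<close>

lemma prob_exit:
  "prob {\<omega> \<in> space M. fst (W n \<omega>) \<in> {1..} \<and> R (length (snd (W n \<omega>)))} =
    measure_pmf.expectation P (\<lambda>j. \<Sum>i=0..int j - 2. green R n i)" (is "?p n = _")
proof (induction n)
  case 0
  then show ?case by (simp add: green_def)
next
  case (Suc n)
  let ?Q = "\<lambda>w. fst w \<in> {1..} \<and> R (length (snd w))"
  let ?V = "\<lambda>i w. fst w = - i \<and> R (length (snd w) + (if i = 0 then 1 else 0))"
  \<comment> \<open>Being stopped after a step means being stopped already or leaving now from one
    of these positions.\<close>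
  have split: "(if ?Q (step {1..} n w j) then 1 else 0 :: real) =
      (if ?Q w then 1 else 0) + (\<Sum>i=0..int j - 2. if ?V i w then 1 else 0)" for w j
  proof -
    have "(\<Sum>i=0..int j - 2. if ?V i w then 1 else 0 :: real) =
        (\<Sum>i=0..int j - 2. if i = - fst w
          then (if R (length (snd w) + (if fst w = 0 then 1 else 0)) then 1 else 0) else 0)"
      by (rule sum.cong) auto
    also have "\<dots> = (if - fst w \<in> {0..int j - 2} \<and> R (length (snd w) + (if fst w = 0 then 1 else 0)) then 1 else 0)"
      by (subst sum.delta) auto
    finally show ?thesis by (auto simp: step_def)
  qed
  have "?p (Suc n) = prob {\<omega> \<in> space M. ?Q (step {1..} n (W n \<omega>) (J n \<omega>))}" by simp
  also have "\<dots> = measure_pmf.expectation P (\<lambda>j. prob {\<omega> \<in> space M. ?Q (step {1..} n (W n \<omega>) j)})"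
    by (rule prob_W_J)
  also have "\<dots> = measure_pmf.expectation P (\<lambda>j. ?p n + (\<Sum>i=0..int j - 2. visit R n i))"
  proof (rule Bochner_Integration.integral_cong[OF refl])
    fix j
    have int: "integrable M (\<lambda>\<omega>. if U (W n \<omega>) then 1 else 0 :: real)" for U
      by (rule integrable_W[where B = 1]) auto
    have "prob {\<omega> \<in> space M. ?Q (step {1..} n (W n \<omega>) j)} =
        expectation (\<lambda>\<omega>. if ?Q (step {1..} n (W n \<omega>) j) then 1 else 0)"
      by (rule prob_W_expectation[of "\<lambda>w. ?Q (step {1..} n w j)" n])
    also have "\<dots> = expectation (\<lambda>\<omega>. (if ?Q (W n \<omega>) then 1 else 0) +
        (\<Sum>i=0..int j - 2. if ?V i (W n \<omega>) then 1 else 0))"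
      by (simp only: split)
    also have "\<dots> = expectation (\<lambda>\<omega>. if ?Q (W n \<omega>) then 1 else 0) +
        (\<Sum>i=0..int j - 2. expectation (\<lambda>\<omega>. if ?V i (W n \<omega>) then 1 else 0))"
      using int[of ?Q] int[of "?V _"]
      by (subst Bochner_Integration.integral_add) (auto intro!: Bochner_Integration.integrable_sum)
    also have "expectation (\<lambda>\<omega>. if ?Q (W n \<omega>) then 1 else 0) = ?p n"
      by (rule prob_W_expectation[of "?Q" n, symmetric])
    also have "(\<Sum>i=0..int j - 2. expectation (\<lambda>\<omega>. if ?V i (W n \<omega>) then 1 else 0)) =
        (\<Sum>i=0..int j - 2. visit R n i)"
    proof (rule sum.cong[OF refl])
      fix i assume "i \<in> {0..int j - 2}"
      then have "visit R n i = prob {\<omega> \<in> space M. ?V i (W n \<omega>)}" by (simp add: visit_def)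
      also have "\<dots> = expectation (\<lambda>\<omega>. if ?V i (W n \<omega>) then 1 else 0)"
        by (rule prob_W_expectation[of "?V i" n])
      finally show "expectation (\<lambda>\<omega>. if ?V i (W n \<omega>) then 1 else 0) = visit R n i" ..
    qed
    finally show "prob {\<omega> \<in> space M. ?Q (step {1..} n (W n \<omega>) j)} = ?p n + (\<Sum>i=0..int j - 2. visit R n i)" .
  qed
  also have "\<dots> = ?p n + measure_pmf.expectation P (\<lambda>j. \<Sum>i=0..int j - 2. visit R n i)"
    using integrable_sum_up[of "visit R n" 1] visit_bounds by simp
  also have "\<dots> = measure_pmf.expectation P (\<lambda>j. (\<Sum>i=0..int j - 2. green R n i) + (\<Sum>i=0..int j - 2. visit R n i))"
    using integrable_sum_up[of "visit R n" 1] visit_bounds integrable_sum_up[of "green R n" "real n"] green_bounds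
    by (subst Bochner_Integration.integral_add) (simp_all add: Suc.IH[simplified])
  finally show ?case by (simp add: green_def sum.distrib)
qed

text \<open>As in \<open>prob_exit\<close>, but the landing point fixes the last position:
  \<open>- i + (j - 1) = l\<close> gives \<open>i = j - 1 - l\<close>.\<close>

lemma prob_land:
  assumes "1 \<le> l"
  shows "prob {\<omega> \<in> space M. fst (W n \<omega>) = l} =
    measure_pmf.expectation P (\<lambda>j. green (\<lambda>_. True) n (int j - 1 - l))" (is "?p n = _")
proof (induction n)
  case 0
  then show ?case using assms by (simp add: green_def)
next
  case (Suc n)
  have split: "(if fst (step {1..} n w j) = l then 1 else 0 :: real) =
      (if fst w = l then 1 else 0) + (if 0 \<le> int j - 1 - l \<and> fst w = - (int j - 1 - l) then 1 else 0)" for w j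
    using assms by (auto simp: step_def)
  have "?p (Suc n) = prob {\<omega> \<in> space M. fst (step {1..} n (W n \<omega>) (J n \<omega>)) = l}" by simp
  also have "\<dots> = measure_pmf.expectation P (\<lambda>j. prob {\<omega> \<in> space M. fst (step {1..} n (W n \<omega>) j) = l})"
    by (rule prob_W_J)
  also have "\<dots> = measure_pmf.expectation P (\<lambda>j. ?p n + visit (\<lambda>_. True) n (int j - 1 - l))"
  proof (rule Bochner_Integration.integral_cong[OF refl])
    fix j
    let ?V = "\<lambda>w. 0 \<le> int j - 1 - l \<and> fst w = - (int j - 1 - l)"
    have int: "integrable M (\<lambda>\<omega>. if U (W n \<omega>) then 1 else 0 :: real)" for U
      by (rule integrable_W[where B = 1]) auto
    have "prob {\<omega> \<in> space M. fst (step {1..} n (W n \<omega>) j) = l} =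
        expectation (\<lambda>\<omega>. if fst (step {1..} n (W n \<omega>) j) = l then 1 else 0)"
      by (rule prob_W_expectation[of "\<lambda>w. fst (step {1..} n w j) = l" n])
    also have "\<dots> = expectation (\<lambda>\<omega>. (if fst (W n \<omega>) = l then 1 else 0) + (if ?V (W n \<omega>) then 1 else 0))"
      by (simp only: split)
    also have "\<dots> = expectation (\<lambda>\<omega>. if fst (W n \<omega>) = l then 1 else 0) + expectation (\<lambda>\<omega>. if ?V (W n \<omega>) then 1 else 0)"
      using int[of "\<lambda>w. fst w = l"] int[of ?V] by (rule Bochner_Integration.integral_add)
    also have "expectation (\<lambda>\<omega>. if fst (W n \<omega>) = l then 1 else 0) = ?p n"
      by (rule prob_W_expectation[of "\<lambda>w. fst w = l" n, symmetric])
    also have "expectation (\<lambda>\<omega>. if ?V (W n \<omega>) then 1 else 0) = prob {\<omega> \<in> space M. ?V (W n \<omega>)}"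
      by (rule prob_W_expectation[of "?V" n, symmetric])
    also have "\<dots> = visit (\<lambda>_. True) n (int j - 1 - l)" by (simp add: visit_def)
    finally show "prob {\<omega> \<in> space M. fst (step {1..} n (W n \<omega>) j) = l} = ?p n + visit (\<lambda>_. True) n (int j - 1 - l)" .
  qed
  also have "\<dots> = ?p n + measure_pmf.expectation P (\<lambda>j. visit (\<lambda>_. True) n (int j - 1 - l))" by simp
  also have "\<dots> = measure_pmf.expectation P (\<lambda>j. green (\<lambda>_. True) n (int j - 1 - l) + visit (\<lambda>_. True) n (int j - 1 - l))"
    by (simp add: Suc.IH)
  finally show ?case by (simp add: green_def)
qed

lemma green_True_tendsto: "(\<lambda>n. green (\<lambda>_. True) n i) \<longlonglongrightarrow> (if 0 \<le> i then 1 / pmf P 0 else 0)"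
proof (cases "0 \<le> i")
  case True
  have "(\<lambda>n. (1 - survival P n i) / pmf P 0) \<longlonglongrightarrow> (1 - 0) / pmf P 0"
    by (intro tendsto_intros survival_tendsto_0) (use p0_pos in simp)
  with True show ?thesis by (simp add: green_True)
qed simp

lemma green_True_le: "green (\<lambda>_. True) n i \<le> 1 / pmf P 0"
  using survival_nonneg[of P n i] p0_pos
  by (cases "0 \<le> i") (auto simp: green_True divide_right_mono)

text \<open>In the limit the Green function is \<open>1 / pmf P 0\<close> at every position at or
  below 0, so the exit probability tends to the mean upward step divided by \<open>pmf P 0\<close>,
  which is 1.\<close>

lemma AE_stopped: "AE \<omega> in M. \<exists>n. fst (W n \<omega>) \<in> {1..}"
proof (rule AE_stoppedI)
  have "(\<lambda>n. measure_pmf.expectation P (\<lambda>j. \<Sum>i=0..int j - 2. green (\<lambda>_. True) n i)) \<longlonglongrightarrow>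
      measure_pmf.expectation P (\<lambda>j. \<Sum>i=0..int j - 2. 1 / pmf P 0)"
  proof (rule integral_dominated_convergence)
    show "integrable P (\<lambda>j. \<Sum>i=0..int j - 2. 1 / pmf P 0)"
      by (rule integrable_sum_up[of _ "1 / pmf P 0"]) simp
    show "AE j in P. (\<lambda>n. \<Sum>i=0..int j - 2. green (\<lambda>_. True) n i) \<longlonglongrightarrow> (\<Sum>i=0..int j - 2. 1 / pmf P 0)"
    proof (intro AE_I2 tendsto_sum)
      fix j i assume "i \<in> {0..int j - 2}"
      then show "(\<lambda>n. green (\<lambda>_. True) n i) \<longlonglongrightarrow> 1 / pmf P 0"
        using green_True_tendsto[of i] by simp
    qed
    show "AE j in P. norm (\<Sum>i=0..int j - 2. green (\<lambda>_. True) n i) \<le> (\<Sum>i=0..int j - 2. 1 / pmf P 0)" for n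
      unfolding real_norm_def
      by (intro AE_I2 order_trans[OF sum_abs sum_mono]) (simp add: green_bounds green_True_le)
  qed auto
  also have "measure_pmf.expectation P (\<lambda>j. \<Sum>i=0..int j - 2. 1 / pmf P 0) =
      measure_pmf.expectation P (\<lambda>j. real (j - 1) / pmf P 0)"
    by (simp only: sum_const_up times_divide_eq_left mult_1)
  also have "\<dots> = 1" using expectation_up p0_pos by simp
  finally show "(\<lambda>n. prob {\<omega> \<in> space M. fst (W n \<omega>) \<in> {1..}}) \<longlonglongrightarrow> 1"
    using prob_exit[of _ "\<lambda>_. True"] by simp
qed

text \<open>Limit of \<open>prob_land\<close>: every \<open>j > l\<close> contributes its mass times
  \<open>1 / pmf P 0\<close>.\<close>

lemma prob_landing:
  assumes "1 \<le> l"
  shows "prob {\<omega> \<in> space M. fst (W_end \<omega>) = l} = measure (measure_pmf P) {j. l < int j} / pmf P 0"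
proof -
  have "(\<lambda>n. measure_pmf.expectation P (\<lambda>j. green (\<lambda>_. True) n (int j - 1 - l))) \<longlonglongrightarrow>
      measure_pmf.expectation P (\<lambda>j. if 0 \<le> int j - 1 - l then 1 / pmf P 0 else 0)"
  proof (rule integral_dominated_convergence)
    show "AE j in P. norm (green (\<lambda>_. True) n (int j - 1 - l)) \<le> 1 / pmf P 0" for n
      by (simp add: green_bounds green_True_le)
    show "AE j in P. (\<lambda>n. green (\<lambda>_. True) n (int j - 1 - l)) \<longlonglongrightarrow> (if 0 \<le> int j - 1 - l then 1 / pmf P 0 else 0)"
      by (intro AE_I2 green_True_tendsto)
  qed auto
  also have "measure_pmf.expectation P (\<lambda>j. if 0 \<le> int j - 1 - l then 1 / pmf P 0 else 0) =
      measure_pmf.expectation P (\<lambda>j. (1 / pmf P 0) * indicator {j. l < int j} j)"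
    by (intro Bochner_Integration.integral_cong refl) auto
  also have "\<dots> = measure (measure_pmf P) {j. l < int j} / pmf P 0" by simp
  finally have "(\<lambda>n. prob {\<omega> \<in> space M. fst (W n \<omega>) = l}) \<longlonglongrightarrow> measure (measure_pmf P) {j. l < int j} / pmf P 0"
    using prob_land[OF assms] by simp
  moreover have "{\<omega> \<in> space M. fst (W n \<omega>) \<in> {1..} \<and> fst (W n \<omega>) = l} = {\<omega> \<in> space M. fst (W n \<omega>) = l}" for n
    using assms by auto
  ultimately show ?thesis
    using prob_W_end_limit[OF AE_stopped, of "\<lambda>w. fst w = l"] by (auto dest: LIMSEQ_unique)
qed

text \<open>Insert \<open>green_count\<close> into \<open>prob_exit\<close>; the number of exit
  positions has mean \<open>pmf P 0\<close>.\<close>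

lemma prob_visits_le:
  "prob {\<omega> \<in> space M. length (snd (W_end \<omega>)) = c} \<le> (if c = 0 then 0 else (1 - pmf P 0) ^ (c - 1) * pmf P 0)"
proof (rule LIMSEQ_le_const2[OF prob_W_end_limit[OF AE_stopped]], intro exI allI impI)
  fix n
  let ?b = "if c = 0 then 0 else (1 - pmf P 0) ^ (c - 1)"
  have b: "0 \<le> ?b" by (simp add: pmf_le_1)
  have "prob {\<omega> \<in> space M. fst (W n \<omega>) \<in> {1..} \<and> length (snd (W n \<omega>)) = c} =
      measure_pmf.expectation P (\<lambda>j. \<Sum>i=0..int j - 2. green (\<lambda>k. k = c) n i)"
    by (rule prob_exit)
  also have "\<dots> \<le> measure_pmf.expectation P (\<lambda>j. ?b * real (j - 1))"
  proof (rule integral_mono)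
    show "integrable P (\<lambda>j. \<Sum>i=0..int j - 2. green (\<lambda>k. k = c) n i)"
      by (rule integrable_sum_up[of _ "real n"]) (simp add: green_bounds)
    show "integrable P (\<lambda>j. ?b * real (j - 1))" using integrable_up by simp
    fix j
    have "(\<Sum>i=0..int j - 2. green (\<lambda>k. k = c) n i) \<le> (\<Sum>i=0..int j - 2. ?b)"
      by (rule sum_mono) (rule green_count)
    also have "\<dots> = ?b * real (j - 1)" by (rule sum_const_up)
    finally show "(\<Sum>i=0..int j - 2. green (\<lambda>k. k = c) n i) \<le> ?b * real (j - 1)" .
  qed
  also have "\<dots> = (if c = 0 then 0 else (1 - pmf P 0) ^ (c - 1) * pmf P 0)" using expectation_up by simp
  finally show "prob {\<omega> \<in> space M. fst (W n \<omega>) \<in> {1..} \<and> length (snd (W n \<omega>)) = c} \<le>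
      (if c = 0 then 0 else (1 - pmf P 0) ^ (c - 1) * pmf P 0)" .
qed

text \<open>The upper bounds of \<open>prob_visits_le\<close> already sum to one, so they are attained.\<close>

lemma prob_visits:
  assumes "1 \<le> c"
  shows "prob {\<omega> \<in> space M. length (snd (W_end \<omega>)) = c} = (1 - pmf P 0) ^ (c - 1) * pmf P 0"
proof -
  let ?p = "\<lambda>c. prob {\<omega> \<in> space M. length (snd (W_end \<omega>)) = c}"
  let ?b = "\<lambda>c. if c = 0 then 0 else (1 - pmf P 0) ^ (c - 1) * pmf P 0"
  have "?p sums prob (\<Union>c. {\<omega> \<in> space M. length (snd (W_end \<omega>)) = c})"
    by (rule finite_measure_UNION) (auto simp: disjoint_family_on_def)
  also have "(\<Union>c. {\<omega> \<in> space M. length (snd (W_end \<omega>)) = c}) = space M" by auto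
  finally have p: "?p sums 1" by (simp add: prob_space)
  have "(\<lambda>c. (1 - pmf P 0) ^ c * pmf P 0) sums (1 / (1 - (1 - pmf P 0)) * pmf P 0)"
    using p0_pos pmf_le_1[of P 0] by (intro sums_mult2 geometric_sums) auto
  then have "(\<lambda>c. ?b (Suc c)) sums 1" using p0_pos by simp
  then have "?b sums 1" using sums_Suc_iff[of ?b 1] by simp
  then have d: "(\<lambda>c. ?b c - ?p c) sums 0" using sums_diff[OF _ p, of ?b 1] by simp
  moreover have "0 \<le> ?b c - ?p c" for c using prob_visits_le[of c] by simp
  ultimately have "?b c - ?p c = 0"
    using suminf_eq_zero_iff[of "\<lambda>c. ?b c - ?p c"] by (simp add: sums_iff)
  with assms show ?thesis by simp
qed

end

section \<open>Geometric sums of exponential times\<close>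

text \<open>\<open>erlang_density k\<close> belongs to \<open>k + 1\<close> summands, so the weight
  \<open>(1 - p) ^ k * p\<close> is the probability of \<open>k + 1\<close> trials. The series in
  \<open>k\<close> is that of exp((1 - p) l x).\<close>

lemma erlang_geometric_mixture:
  assumes l: "0 < l" and p: "0 < p" "p \<le> 1"
  shows "(\<Sum>k. ennreal ((1 - p) ^ k * p) * ennreal (erlang_density k l x)) = ennreal (exponential_density (p * l) x)"
proof -
  have "(\<lambda>k. (1 - p) ^ k * p * erlang_density k l x) sums exponential_density (p * l) x"
  proof (cases "x < 0")
    case True
    then show ?thesis by (simp add: erlang_density_def)
  next
    case False
    have "(\<lambda>k. p * l * exp (- l * x) * (((1 - p) * (l * x)) ^ k / fact k)) sums
        (p * l * exp (- l * x) * exp ((1 - p) * (l * x)))"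
      by (intro sums_mult exp_sums_real)
    also have "p * l * exp (- l * x) * exp ((1 - p) * (l * x)) = p * l * exp (- x * (p * l))"
      by (simp add: exp_add[symmetric] algebra_simps)
    also have "(\<lambda>k. p * l * exp (- l * x) * (((1 - p) * (l * x)) ^ k / fact k)) =
        (\<lambda>k. (1 - p) ^ k * p * erlang_density k l x)"
      using False by (auto simp: fun_eq_iff erlang_density_def power_mult_distrib)
    finally show ?thesis using False by (simp add: exponential_density_def)
  qed
  then have "(\<Sum>k. ennreal ((1 - p) ^ k * p * erlang_density k l x)) = ennreal (exponential_density (p * l) x)"
    using p l by (intro suminf_ennreal_eq) auto
  then show ?thesis using p l by (simp add: ennreal_mult)
qed

context prob_space
begin

lemma indep_vars_inj:
  assumes "indep_vars (\<lambda>_. N) X UNIV" and f: "inj f"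
  shows "indep_vars (\<lambda>_. N) (\<lambda>i. X (f i)) UNIV"
proof -
  have "indep_vars (\<lambda>i. PiM {f i} (\<lambda>_. N)) (\<lambda>i \<omega>. restrict (\<lambda>s. X s \<omega>) {f i}) UNIV"
    using f by (intro indep_vars_restrict[OF assms(1)]) (auto simp: disjoint_family_on_def inj_eq)
  then have "indep_vars (\<lambda>_. N) (\<lambda>i \<omega>. restrict (\<lambda>s. X s \<omega>) {f i} (f i)) UNIV"
    by (rule indep_vars_compose2[where Y = "\<lambda>i g. g (f i)"]) (rule measurable_component_singleton, simp)
  then show ?thesis by simp
qed

text \<open>The summation indices are a function of the \<open>Z\<close> alone, hence independent of
  the \<open>E\<close>. Given them, the sum has an Erlang law that depends only on their number, and
  this number is geometric.\<close>

lemma geometric_sum_exponential: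
  fixes E Z :: "nat \<Rightarrow> 'a \<Rightarrow> real" and v :: "(nat \<Rightarrow> real) \<Rightarrow> nat list"
  assumes indep: "indep_vars (\<lambda>_. borel) (case_sum E Z) UNIV"
    and expE: "\<And>k. distributed M lborel (E k) (exponential_density l)" and l: "0 < l"
    and v: "v \<in> PiM UNIV (\<lambda>_. borel) \<rightarrow>\<^sub>M count_space UNIV"
    and v_distinct: "\<And>z. distinct (v z)"
    and v_Nil: "AE \<omega> in M. v (\<lambda>i. Z i \<omega>) \<noteq> []"
    and p: "0 < p" "p \<le> 1"
    and geo: "\<And>c. 1 \<le> c \<Longrightarrow> prob {\<omega> \<in> space M. length (v (\<lambda>i. Z i \<omega>)) = c} = (1 - p) ^ (c - 1) * p"
  shows "distributed M lborel (\<lambda>\<omega>. \<Sum>i\<in>set (v (\<lambda>i. Z i \<omega>)). E i \<omega>) (exponential_density (p * l))"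
proof -
  let ?N = "\<lambda>\<omega>. v (\<lambda>i. Z i \<omega>)"
  let ?T = "\<lambda>\<omega>. \<Sum>i\<in>set (?N \<omega>). E i \<omega>"
  let ?B = "borel :: real measure"
  let ?L = "PiM (range Inl) (\<lambda>_. ?B) :: (nat + nat \<Rightarrow> real) measure"
  let ?R = "PiM (range Inr) (\<lambda>_. ?B) :: (nat + nat \<Rightarrow> real) measure"
  let ?e = "\<lambda>\<omega>. restrict (\<lambda>s. case_sum E Z s \<omega>) (range Inl)"
  let ?z = "\<lambda>\<omega>. restrict (\<lambda>s. case_sum E Z s \<omega>) (range Inr)"
  have meas: "case_sum E Z s \<in> borel_measurable M" for s
    using indep by (simp add: indep_vars_def)
  have E [measurable]: "E i \<in> borel_measurable M" and Z [measurable]: "Z i \<in> borel_measurable M" for i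
    using meas[of "Inl i"] meas[of "Inr i"] by simp_all
  have N [measurable]: "?N \<in> M \<rightarrow>\<^sub>M count_space UNIV" by (rule measurable_compose[OF measurable_abs_UNIV v]) (rule Z)
  have T [measurable]: "?T \<in> borel_measurable M"
    by (rule measurable_compose_countable[where g = ?N and f = "\<lambda>xs \<omega>. \<Sum>i\<in>set xs. E i \<omega>"]) measurable
  have iv: "indep_var ?L ?e ?R ?z"
    by (rule indep_var_restrict[OF indep]) auto
  have e [measurable]: "?e \<in> M \<rightarrow>\<^sub>M ?L" and z [measurable]: "?z \<in> M \<rightarrow>\<^sub>M ?R"
    using indep_var_rv1[OF iv] indep_var_rv2[OF iv] by auto
  interpret PL: prob_space "distr M ?L ?e" by (rule prob_space_distr) fact
  interpret PR: prob_space "distr M ?R ?z" by (rule prob_space_distr) fact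
  interpret LR: pair_prob_space "distr M ?L ?e" "distr M ?R ?z" ..
  have Inl [measurable]: "(\<lambda>a. a (Inl i)) \<in> borel_measurable ?L" for i
    by (rule measurable_component_singleton) simp
  have Inr [measurable]: "(\<lambda>b. b (Inr i)) \<in> borel_measurable ?R" for i
    by (rule measurable_component_singleton) simp
  have vR [measurable]: "(\<lambda>b. v (\<lambda>i. b (Inr i))) \<in> ?R \<rightarrow>\<^sub>M count_space UNIV"
    by (rule measurable_compose[OF measurable_abs_UNIV v]) (rule Inr)
  let ?t = "\<lambda>(a, b). \<Sum>i\<in>set (v (\<lambda>i. b (Inr i))). a (Inl i)"
  have "(\<lambda>x. \<Sum>i\<in>set (v (\<lambda>i. snd x (Inr i))). fst x (Inl i)) \<in> borel_measurable (?L \<Otimes>\<^sub>M ?R)"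
    by (rule measurable_compose_countable[where g = "\<lambda>x. v (\<lambda>i. snd x (Inr i))"
          and f = "\<lambda>xs x. \<Sum>i\<in>set xs. fst x (Inl i)"]) measurable
  then have t [measurable]: "?t \<in> borel_measurable (?L \<Otimes>\<^sub>M ?R)" by (simp add: case_prod_beta)
  have sum_law: "(\<integral>\<^sup>+\<omega>. indicator A (\<Sum>i\<in>set xs. E i \<omega>) \<partial>M) =
      (\<integral>\<^sup>+x. ennreal (erlang_density (length xs - 1) l x) * indicator A x \<partial>lborel)"
    if [measurable]: "A \<in> sets borel" and xs: "distinct xs" "xs \<noteq> []" for A xs
  proof -
    have "indep_vars (\<lambda>_. borel) E UNIV"
      using indep_vars_inj[OF indep, of Inl] by simp
    then have "indep_vars (\<lambda>_. borel) E (set xs)" by (rule indep_vars_subset) simp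
    then have D: "distributed M lborel (\<lambda>\<omega>. \<Sum>i\<in>set xs. E i \<omega>) (erlang_density (card (set xs) - 1) l)"
      using expE l xs by (intro exponential_distributed_sum) auto
    show ?thesis
      using distributed_nn_integral[OF D, of "indicator A"] xs by (simp add: distinct_card)
  qed
  have "distr M lborel ?T = density lborel (exponential_density (p * l))"
  proof (rule measure_eqI)
    fix A assume "A \<in> sets (distr M lborel ?T)"
    then have A [measurable]: "A \<in> sets borel" by simp
    let ?F = "\<lambda>k. \<integral>\<^sup>+x. ennreal (erlang_density k l x) * indicator A x \<partial>lborel"
    have "emeasure (distr M lborel ?T) A = (\<integral>\<^sup>+\<omega>. indicator A (?T \<omega>) \<partial>M)"
      by (simp add: nn_integral_distr flip: nn_integral_indicator)
    also have "\<dots> = (\<integral>\<^sup>+x. indicator A (?t x) \<partial>distr M (?L \<Otimes>\<^sub>M ?R) (\<lambda>\<omega>. (?e \<omega>, ?z \<omega>)))"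
      by (subst nn_integral_distr) auto
    also have "distr M (?L \<Otimes>\<^sub>M ?R) (\<lambda>\<omega>. (?e \<omega>, ?z \<omega>)) = distr M ?L ?e \<Otimes>\<^sub>M distr M ?R ?z"
      using iv unfolding indep_var_distribution_eq by simp
    also have "(\<integral>\<^sup>+x. indicator A (?t x) \<partial>(distr M ?L ?e \<Otimes>\<^sub>M distr M ?R ?z)) =
        (\<integral>\<^sup>+b. \<integral>\<^sup>+a. indicator A (?t (a, b)) \<partial>distr M ?L ?e \<partial>distr M ?R ?z)"
      by (rule LR.nn_integral_snd[symmetric]) simp
    also have "\<dots> = (\<integral>\<^sup>+b. \<integral>\<^sup>+\<omega>. indicator A (\<Sum>i\<in>set (v (\<lambda>i. b (Inr i))). E i \<omega>) \<partial>M \<partial>distr M ?R ?z)"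
      by (intro nn_integral_cong) (subst nn_integral_distr, auto)
    \<comment> \<open>\<omega>' drives the index list and \<omega> the summands: independence has
      become two separate integrals over \<open>M\<close>.\<close>
    also have "\<dots> = (\<integral>\<^sup>+\<omega>'. \<integral>\<^sup>+\<omega>. indicator A (\<Sum>i\<in>set (?N \<omega>'). E i \<omega>) \<partial>M \<partial>M)"
    proof -
      have "(\<lambda>b. \<integral>\<^sup>+\<omega>. indicator A (\<Sum>i\<in>set (v (\<lambda>i. b (Inr i))). E i \<omega>) \<partial>M) \<in> borel_measurable ?R"
        by (rule measurable_compose[OF vR, of "\<lambda>xs. \<integral>\<^sup>+\<omega>. indicator A (\<Sum>i\<in>set xs. E i \<omega>) \<partial>M"]) simp
      then show ?thesis using nn_integral_distr[OF z] by simp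
    qed
    also have "\<dots> = (\<integral>\<^sup>+\<omega>'. (\<Sum>k. ?F k * indicator {\<omega> \<in> space M. length (?N \<omega>) = Suc k} \<omega>') \<partial>M)"
    proof (rule nn_integral_cong_AE)
      show "AE \<omega>' in M. (\<integral>\<^sup>+\<omega>. indicator A (\<Sum>i\<in>set (?N \<omega>'). E i \<omega>) \<partial>M) =
          (\<Sum>k. ?F k * indicator {\<omega> \<in> space M. length (?N \<omega>) = Suc k} \<omega>')"
        using v_Nil AE_space
      proof eventually_elim
        case (elim \<omega>')
        let ?k = "length (?N \<omega>') - 1"
        have k: "length (?N \<omega>') = Suc ?k" using elim(1) by (cases "?N \<omega>'") auto
        \<comment> \<open>The list is nonempty, so its length selects exactly one term of the
          series.\<close>
        have "(\<lambda>k. ?F k * indicator {\<omega> \<in> space M. length (?N \<omega>) = Suc k} \<omega>') =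
            (\<lambda>k. if k = ?k then ?F ?k else 0)"
          using elim(2) k by (auto simp: fun_eq_iff)
        then show ?case
          using sums_unique[OF sums_single[of ?k "\<lambda>_. ?F ?k"]] sum_law[OF A v_distinct elim(1)] by simp
      qed
    qed
    also have "\<dots> = (\<Sum>k. \<integral>\<^sup>+\<omega>'. ?F k * indicator {\<omega> \<in> space M. length (?N \<omega>) = Suc k} \<omega>' \<partial>M)"
      by (rule nn_integral_suminf) measurable
    also have "\<dots> = (\<Sum>k. \<integral>\<^sup>+x. ennreal ((1 - p) ^ k * p) * ennreal (erlang_density k l x) * indicator A x \<partial>lborel)"
    proof (rule suminf_cong)
      fix k
      have "(\<integral>\<^sup>+\<omega>'. ?F k * indicator {\<omega> \<in> space M. length (?N \<omega>) = Suc k} \<omega>' \<partial>M) =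
          ?F k * emeasure M {\<omega> \<in> space M. length (?N \<omega>) = Suc k}"
        by (rule nn_integral_cmult_indicator) measurable
      also have "emeasure M {\<omega> \<in> space M. length (?N \<omega>) = Suc k} = ennreal ((1 - p) ^ k * p)"
        using geo[of "Suc k"] by (simp add: emeasure_eq_measure)
      also have "?F k * ennreal ((1 - p) ^ k * p) =
          (\<integral>\<^sup>+x. ennreal ((1 - p) ^ k * p) * (ennreal (erlang_density k l x) * indicator A x) \<partial>lborel)"
        by (subst nn_integral_cmult) (auto simp: mult.commute)
      finally show "(\<integral>\<^sup>+\<omega>'. ?F k * indicator {\<omega> \<in> space M. length (?N \<omega>) = Suc k} \<omega>' \<partial>M) =
          (\<integral>\<^sup>+x. ennreal ((1 - p) ^ k * p) * ennreal (erlang_density k l x) * indicator A x \<partial>lborel)"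
        by (simp add: mult.assoc)
    qed
    also have "\<dots> = (\<integral>\<^sup>+x. (\<Sum>k. ennreal ((1 - p) ^ k * p) * ennreal (erlang_density k l x) * indicator A x) \<partial>lborel)"
      by (rule nn_integral_suminf[symmetric]) simp
    also have "\<dots> = (\<integral>\<^sup>+x. ennreal (exponential_density (p * l) x) * indicator A x \<partial>lborel)"
      by (simp add: ennreal_suminf_multc erlang_geometric_mixture[OF l p])
    also have "\<dots> = emeasure (density lborel (exponential_density (p * l))) A"
      by (simp add: emeasure_density)
    finally show "emeasure (distr M lborel ?T) A = emeasure (density lborel (exponential_density (p * l))) A" .
  qed simp
  then show ?thesis by (simp add: distributed_def)
qed

end

section \<open>From the walk to the path\<close>

text \<open>The walk starts at 0 outside \<open>S\<close>, so time 0 is recorded by the first step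
  and never dropped.\<close>

lemma walk_nonempty:
  assumes "0 \<notin> S"
  shows "snd (walk S j (Suc n)) \<noteq> []"
  using assms by (induction n) (auto simp: step_def)

lemma walk_visits: "distinct (snd (walk S j n)) \<and> (\<forall>i\<in>set (snd (walk S j n)). i < n)"
  by (induction n) (auto simp: step_def intro: less_SucI)

lemma walk_end_distinct: "distinct (snd (walk_end S j))"
  using walk_visits unfolding walk_end_def by blast

lemma walk_before:
  assumes "\<And>i. i < n \<Longrightarrow> fst (walk S j i) \<notin> S"
  shows "fst (walk S j n) = (\<Sum>i<n. int (j i) - 1)"
    and "set (snd (walk S j n)) = {i. i < n \<and> fst (walk S j i) = 0}"
proof -
  have "fst (walk S j n) = (\<Sum>i<n. int (j i) - 1) \<and> set (snd (walk S j n)) = {i. i < n \<and> fst (walk S j i) = 0}"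
    using assms
  proof (induction n)
    case 0
    show ?case by simp
  next
    case (Suc n)
    have IH: "fst (walk S j n) = (\<Sum>i<n. int (j i) - 1)"
        "set (snd (walk S j n)) = {i. i < n \<and> fst (walk S j i) = 0}"
      using Suc.IH[OF Suc.prems] by (simp_all only: less_SucI)
    have step: "walk S j (Suc n) = (fst (walk S j n) + int (j n) - 1,
        if fst (walk S j n) = 0 then n # snd (walk S j n) else snd (walk S j n))"
      using Suc.prems[of n] by (simp add: step_def)
    have "fst (walk S j (Suc n)) = (\<Sum>i<Suc n. int (j i) - 1)"
      unfolding step by (simp add: IH(1))
    moreover have "{i. i < Suc n \<and> Q i} = (if Q n then insert n {i. i < n \<and> Q i} else {i. i < n \<and> Q i})" for Q
      by (auto simp: less_Suc_eq)
    then have "set (snd (walk S j (Suc n))) = {i. i < Suc n \<and> fst (walk S j i) = 0}"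
      unfolding step by (simp only: IH(2)[symmetric] snd_conv if_distrib[of set] list.set)
    ultimately show ?case ..
  qed
  then show "fst (walk S j n) = (\<Sum>i<n. int (j i) - 1)"
    "set (snd (walk S j n)) = {i. i < n \<and> fst (walk S j i) = 0}" by blast+
qed

text \<open>Before the stopping index the path is in \<open>D\<close> only when the walk is at 0, so
  the recorded visits are exactly the live holding intervals, and \<open>first_jump\<close> applies
  with \<open>m\<close> the stopping index.\<close>

lemma first_jump_walk:
  fixes x h :: real and e :: "nat \<Rightarrow> real"
  assumes e: "\<And>i. 0 < e i"
    and f: "\<And>t. 0 \<le> t \<Longrightarrow> f t = x + (\<Sum>k | (\<Sum>i\<le>k. e i) \<le> t. (real (j k) - 1) * h)"
    and stop: "\<exists>n. fst (walk S j n) \<in> S"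
    and S: "0 \<notin> S"
    and live: "\<And>k::int. k \<notin> S \<Longrightarrow> x + of_int k * h \<in> D \<longleftrightarrow> k = 0"
    and stopped: "\<And>k::int. k \<in> S \<Longrightarrow> x + of_int k * h \<in> D"
    and h: "0 < h"
  defines "T \<equiv> (\<Sum>i\<in>set (snd (walk_end S j)). e i)"
  shows "is_first_jump_time (delete_outside D f) T"
    and "delete_outside D f T = x + of_int (fst (walk_end S j)) * h"
proof -
  define m where "m = (LEAST n. fst (walk S j n) \<in> S)"
  have m: "fst (walk S j m) \<in> S" using stop unfolding m_def by (rule LeastI_ex)
  have before: "fst (walk S j i) \<notin> S" if "i < m" for i
    using not_less_Least that unfolding m_def by blast
  have walk_end: "walk_end S j = walk S j m" by (rule walk_end_eq) (rule m)
  define X where "X n = x + of_int (\<Sum>i<n. int (j i) - 1) * h" for n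
  have X: "X n = x + of_int (fst (walk S j n)) * h" if "n \<le> m" for n
    using walk_before(1)[of n S j] before that by (simp add: X_def)
  have mono: "(\<Sum>i<k. e i) \<le> (\<Sum>i<n. e i)" if "k \<le> n" for k n
    using that e by (intro sum_mono2) (auto intro: less_imp_le)
  interpret step_path D f e X m
  proof
    fix n t assume t: "(\<Sum>i<n. e i) \<le> t" "t < (\<Sum>i<Suc n. e i)"
    \<comment> \<open>The \<open>k\<close>-th jump, counted from 0, ends holding interval
      \<open>k\<close>; hence exactly the jumps \<open>k < n\<close> have happened by time
      \<open>t\<close>.\<close>
    have "(\<Sum>i\<le>k. e i) \<le> t \<longleftrightarrow> k < n" for k
    proof (cases "k < n")
      case True
      then show ?thesis using mono[of "Suc k" n] t(1) unfolding lessThan_Suc_atMost by linarith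
    next
      case False
      then show ?thesis using mono[of "Suc n" "Suc k"] t(2) unfolding lessThan_Suc_atMost by linarith
    qed
    moreover have "0 \<le> t" using t(1) mono[of 0 n] by simp
    ultimately show "f t = X n"
      by (simp add: f X_def lessThan_def[symmetric] sum_distrib_right)
  qed (rule e)
  have X0: "X 0 \<in> D" using live[OF S] by (simp add: X_def)
  have Xm: "X m \<in> D" "X m \<noteq> X 0"
  proof -
    show "X m \<in> D" using stopped[OF m] by (simp only: X)
    have "fst (walk S j m) \<noteq> 0" using m S by metis
    then show "X m \<noteq> X 0" using h by (simp add: X)
  qed
  have Xn: "X n \<in> D \<longleftrightarrow> fst (walk S j n) = 0" if "n < m" for n
    using X[of n] live before[OF that] that by simp
  have "live_time m = (\<Sum>i<m. if fst (walk S j i) = 0 then e i else 0)"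
    unfolding live_time_def using Xn by (intro sum.cong) auto
  also have "\<dots> = sum e {i \<in> {..<m}. fst (walk S j i) = 0}"
    by (rule sum.inter_filter[symmetric]) simp
  also have "{i \<in> {..<m}. fst (walk S j i) = 0} = set (snd (walk_end S j))"
    unfolding walk_end using walk_before(2)[OF before] by auto
  also have "sum e (set (snd (walk_end S j))) = T" by (simp add: T_def)
  finally have T: "live_time m = T" .
  have "X n = X 0" if "n < m" "X n \<in> D" for n
  proof -
    have "X n = x" using X[of n] Xn[of n] that by simp
    then show ?thesis unfolding X_def[of 0] by simp
  qed
  note jump = first_jump[OF X0 Xm this, unfolded T X[OF order_refl] walk_end[symmetric]]
  show "is_first_jump_time (delete_outside D f) T"
    by (rule jump(1))
  show "delete_outside D f T = x + of_int (fst (walk_end S j)) * h"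
    by (rule jump(2))
qed

section \<open>The compound Poisson process\<close>

context spectrally_positive
begin

section \<open>The jump chain as a critical walk\<close>

definition jump_rate :: real where "jump_rate = - G 1"

text \<open>Index 1 is a step of size 0 with a negative coefficient, so it is given mass 0; the
  remaining coefficients sum to \<open>jump_rate\<close>.\<close>

definition jump_prob :: "nat \<Rightarrow> real" where
  "jump_prob j = (if j = 1 then 0 else G j / jump_rate)"

definition jump_pmf :: "nat pmf" where "jump_pmf = embed_pmf jump_prob"

lemma jump_rate_pos: "0 < jump_rate"
  using G_1_neg by (simp add: jump_rate_def)

lemma jump_prob_nonneg: "0 \<le> jump_prob j"
  using G_nonneg[of j] jump_rate_pos by (simp add: jump_prob_def)

lemma G_sums_rate: "(\<lambda>j. if j = 1 then 0 else G j) sums jump_rate"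
proof -
  have "(\<lambda>j. G j - (if j = 1 then G 1 else 0)) sums (0 - G 1)"
    using sums_single[of 1 "\<lambda>_. G 1"] by (intro sums_diff G_sums_0) simp
  also have "(\<lambda>j. G j - (if j = 1 then G 1 else 0)) = (\<lambda>j. if j = 1 then 0 else G j)" by auto
  finally show ?thesis by (simp add: jump_rate_def)
qed

lemma jump_prob_sums: "jump_prob sums 1"
proof -
  have "(\<lambda>j. (if j = 1 then 0 else G j) / jump_rate) sums (jump_rate / jump_rate)"
    by (intro sums_divide G_sums_rate)
  also have "(\<lambda>j. (if j = 1 then 0 else G j) / jump_rate) = jump_prob" by (auto simp: jump_prob_def)
  finally show ?thesis using jump_rate_pos by simp
qed

lemma pmf_jump: "pmf jump_pmf j = jump_prob j"
  unfolding jump_pmf_def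
proof (rule pmf_embed_pmf)
  show "(\<integral>\<^sup>+ j. ennreal (jump_prob j) \<partial>count_space UNIV) = 1"
    using suminf_ennreal_eq[OF jump_prob_nonneg jump_prob_sums] by (simp add: nn_integral_count_space_nat)
qed (rule jump_prob_nonneg)

lemma jump_mean_sums: "(\<lambda>j. jump_prob j * real j) sums 1"
proof -
  have "(\<lambda>j. (real j - 1) * G j / jump_rate) sums (0 / jump_rate)"
    by (intro sums_divide G_drift_sums_0)
  \<comment> \<open>The factor vanishes at \<open>j = 1\<close>, where \<open>jump_prob\<close>
    departs from \<open>G j / jump_rate\<close>.\<close>
  also have "(\<lambda>j. (real j - 1) * G j / jump_rate) = (\<lambda>j. (real j - 1) * jump_prob j)"
    by (rule ext) (simp add: jump_prob_def)
  finally have "(\<lambda>j. (real j - 1) * jump_prob j + jump_prob j) sums (0 / jump_rate + 1)"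
    by (intro sums_add jump_prob_sums)
  moreover have "(\<lambda>j. (real j - 1) * jump_prob j + jump_prob j) = (\<lambda>j. jump_prob j * real j)"
    by (rule ext) (simp add: left_diff_distrib mult.commute)
  ultimately show ?thesis by (simp only: div_0 add_0)
qed

sublocale critical_law jump_pmf
proof
  have "(\<integral>\<^sup>+ j. ennreal (real j) \<partial>measure_pmf jump_pmf) = (\<Sum>j. ennreal (jump_prob j * real j))"
    unfolding nn_integral_measure_pmf nn_integral_count_space_nat pmf_jump
    by (intro suminf_cong ennreal_mult[symmetric] jump_prob_nonneg of_nat_0_le_iff)
  also have "\<dots> = 1"
    unfolding ennreal_1[symmetric]
    by (intro suminf_ennreal_eq jump_mean_sums mult_nonneg_nonneg jump_prob_nonneg of_nat_0_le_iff)
  finally have nn: "(\<integral>\<^sup>+ j. ennreal (real j) \<partial>measure_pmf jump_pmf) = 1" .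
  show "integrable jump_pmf real"
    by (rule integrableI_nonneg) (use nn in auto)
  show "measure_pmf.expectation jump_pmf real = 1"
    by (subst integral_eq_nn_integral) (use nn in auto)
  show "0 < pmf jump_pmf 0"
    using G_0_pos jump_rate_pos by (simp add: pmf_jump jump_prob_def)
qed

section \<open>The jump measure and its lattice\<close>

lemma emeasure_jump_measure:
  assumes [measurable]: "B \<in> sets borel"
  shows "emeasure (jump_measure \<phi> h) B = (\<Sum>j. ennreal (if j \<noteq> 1 \<and> (real j - 1) * h \<in> B then G j else 0))"
proof -
  let ?f = "\<lambda>j::nat. (real j - 1) * h"
  let ?C = "count_space (UNIV - {1 :: nat})"
  have "emeasure (jump_measure \<phi> h) B = emeasure (density ?C (\<lambda>j. ennreal (G j))) (?f -` B \<inter> (UNIV - {1}))"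
    unfolding jump_measure_def Gcoeff_eq by (subst emeasure_distr) (auto intro: assms)
  also have "\<dots> = (\<integral>\<^sup>+ j. ennreal (G j) * indicator (?f -` B \<inter> (UNIV - {1})) j \<partial>?C)"
    by (rule emeasure_density) auto
  also have "\<dots> = (\<integral>\<^sup>+ j. ennreal (G j) * indicator (?f -` B \<inter> (UNIV - {1})) j * indicator (UNIV - {1}) j \<partial>count_space UNIV)"
    by (subst nn_integral_count_space_indicator) auto
  also have "\<dots> = (\<Sum>j. ennreal (if j \<noteq> 1 \<and> ?f j \<in> B then G j else 0))"
    unfolding nn_integral_count_space_nat by (intro suminf_cong) (auto simp: indicator_def)
  finally show ?thesis .
qed

lemma measure_jump_UNIV: "measure (jump_measure \<phi> h) UNIV = jump_rate"
proof -
  have "emeasure (jump_measure \<phi> h) UNIV = (\<Sum>j. ennreal (if j = 1 then 0 else G j))"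
    by (subst emeasure_jump_measure) (auto intro!: suminf_cong)
  also have "\<dots> = ennreal jump_rate"
    using G_nonneg by (intro suminf_ennreal_eq G_sums_rate) auto
  finally show ?thesis using jump_rate_pos by (simp add: measure_def)
qed

text \<open>A measurable left inverse of the embedding of indices into jump sizes; off the lattice
  its value carries no meaning.\<close>

definition jump_index :: "real \<Rightarrow> nat" where
  "jump_index z = nat \<lfloor>z / h + 1\<rfloor>"

lemma jump_index_measurable [measurable]: "jump_index \<in> borel \<rightarrow>\<^sub>M count_space UNIV"
  unfolding jump_index_def[abs_def] by measurable

lemma jump_index_eq: "jump_index ((real j - 1) * h) = j"
  using h_pos by (simp add: jump_index_def)

lemma measure_jump_index:
  "measure (jump_measure \<phi> h) (jump_index -` {j}) = jump_rate * jump_prob j"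
proof -
  have [measurable]: "jump_index -` {j} \<in> sets borel"
    using measurable_sets[OF jump_index_measurable, of "{j}"] by simp
  have "(\<lambda>i. ennreal (if i \<noteq> 1 \<and> (real i - 1) * h \<in> jump_index -` {j} then G i else 0)) =
      (\<lambda>i. ennreal (if i = j then if j \<noteq> 1 then G j else 0 else 0))"
    by (rule ext) (simp only: vimage_eq jump_index_eq singleton_iff; simp)
  then have "emeasure (jump_measure \<phi> h) (jump_index -` {j}) =
      (\<Sum>i. ennreal (if i = j then if j \<noteq> 1 then G j else 0 else 0))"
    by (subst emeasure_jump_measure) simp_all
  also have "\<dots> = ennreal (if j \<noteq> 1 then G j else 0)"
    using G_nonneg[of j] by (intro suminf_ennreal_eq sums_single) auto
  finally show ?thesis
    using jump_rate_pos G_nonneg[of j] by (simp add: measure_def jump_prob_def)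
qed

text \<open>All mass sits on the lattice, so almost surely a jump size can be recovered from its
  index.\<close>

lemma measure_jump_lattice:
  "measure (jump_measure \<phi> h) {z. z = (real (jump_index z) - 1) * h} = jump_rate"
proof -
  have [measurable]: "{z. z = (real (jump_index z) - 1) * h} \<in> sets borel" by measurable
  have "emeasure (jump_measure \<phi> h) {z. z = (real (jump_index z) - 1) * h} =
      emeasure (jump_measure \<phi> h) UNIV"
    by (subst (1 2) emeasure_jump_measure) (simp_all only: mem_Collect_eq jump_index_eq UNIV_I, measurable)
  then show ?thesis using measure_jump_UNIV by (simp add: measure_def)
qed

text \<open>Replaces the jump sizes by their indices. The last property is stated for every stopping
  set, so it serves both passages; the thinned rate is
  \<open>pmf jump_pmf 0 * jump_rate = G 0\<close>.\<close>

lemma compound_poisson_walk: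
  fixes M :: "'w measure"
  assumes cp: "compound_poisson M (jump_measure \<phi> h) x Y"
  obtains E :: "nat \<Rightarrow> 'w \<Rightarrow> real" and J :: "nat \<Rightarrow> 'w \<Rightarrow> nat" where
    "stopped_walk M jump_pmf J"
    "AE \<omega> in M. (\<forall>i. 0 < E i \<omega>) \<and>
       (\<forall>t\<ge>0. Y t \<omega> = x + (\<Sum>k | (\<Sum>i\<le>k. E i \<omega>) \<le> t. (real (J k \<omega>) - 1) * h))"
    "\<And>S. 0 \<notin> S \<Longrightarrow> AE \<omega> in M. \<exists>n. fst (walk S (\<lambda>i. J i \<omega>) n) \<in> S \<Longrightarrow>
       (\<And>c. 1 \<le> c \<Longrightarrow> measure M {\<omega> \<in> space M. length (snd (walk_end S (\<lambda>i. J i \<omega>))) = c} =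
          (1 - pmf jump_pmf 0) ^ (c - 1) * pmf jump_pmf 0) \<Longrightarrow>
       distributed M lborel (\<lambda>\<omega>. \<Sum>i\<in>set (snd (walk_end S (\<lambda>i. J i \<omega>))). E i \<omega>) (exponential_density (G 0))"
proof -
  from cp interpret prob_space M by (simp add: compound_poisson_def)
  from cp obtain E Z :: "nat \<Rightarrow> 'w \<Rightarrow> real" where
    indep: "indep_vars (\<lambda>_. borel) (case_sum E Z) UNIV"
    and E: "\<And>k. distributed M lborel (E k) (exponential_density jump_rate)"
    and Z: "\<And>k B. B \<in> sets borel \<Longrightarrow> prob (Z k -` B \<inter> space M) = measure (jump_measure \<phi> h) B / jump_rate"
    and Y: "AE \<omega> in M. \<forall>t\<ge>0. Y t \<omega> = x + (\<Sum>k | (\<Sum>i\<le>k. E i \<omega>) \<le> t. Z k \<omega>)"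
    unfolding compound_poisson_def measure_jump_UNIV by blast
  define J where "J k \<omega> = jump_index (Z k \<omega>)" for k \<omega>
  have indep_Z: "indep_vars (\<lambda>_. borel) Z UNIV"
    using indep_vars_inj[OF indep, of Inr] by simp
  have Z_meas [measurable]: "Z k \<in> borel_measurable M" for k
    using indep_Z by (simp add: indep_vars_def)
  have J_meas [measurable]: "J k \<in> M \<rightarrow>\<^sub>M count_space UNIV" for k
    unfolding J_def[abs_def] by measurable
  interpret SW: stopped_walk M jump_pmf J S for S
  proof
    show "indep_vars (\<lambda>_. count_space UNIV) J UNIV"
      unfolding J_def[abs_def] by (rule indep_vars_compose2[OF indep_Z]) measurable
    show "distr M (count_space UNIV) (J n) = measure_pmf jump_pmf" for n
    proof (rule measure_eqI_countable[of _ UNIV])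
      fix j :: nat
      have "jump_index -` {j} \<in> sets borel"
        using measurable_sets[OF jump_index_measurable, of "{j}"] by simp
      then have "prob (Z n -` (jump_index -` {j}) \<inter> space M) = jump_prob j"
        using Z measure_jump_index jump_rate_pos by simp
      moreover have "Z n -` (jump_index -` {j}) \<inter> space M = J n -` {j} \<inter> space M"
        by (auto simp: J_def)
      ultimately show "emeasure (distr M (count_space UNIV) (J n)) {j} = emeasure (measure_pmf jump_pmf) {j}"
        by (simp add: emeasure_distr emeasure_eq_measure emeasure_pmf_single pmf_jump)
    qed auto
  qed
  have "AE \<omega> in M. 0 < E i \<omega>" for i
  proof -
    \<comment> \<open>The density is positive at 0, so this point is removed as a null set.\<close>
    have "AE x in lborel. 0 < ennreal (exponential_density jump_rate x) \<longrightarrow> 0 < x"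
      using AE_lborel_singleton[of 0] by eventually_elim (auto simp: erlang_density_def)
    then show ?thesis using distributed_AE2[OF E, of "\<lambda>x. 0 < x" i] by simp
  qed
  then have E_pos: "AE \<omega> in M. \<forall>i. 0 < E i \<omega>" by (simp add: AE_all_countable)
  have "AE \<omega> in M. Z k \<omega> = (real (J k \<omega>) - 1) * h" for k
  proof -
    let ?B = "{z. z = (real (jump_index z) - 1) * h}"
    have B: "?B \<in> sets borel" by measurable
    have "prob (Z k -` ?B \<inter> space M) = 1"
      using Z[OF B] measure_jump_lattice jump_rate_pos by simp
    then have "AE \<omega> in M. \<omega> \<in> Z k -` ?B \<inter> space M"
      using measurable_sets[OF Z_meas B] by (subst (asm) prob_eq_1) auto
    then show ?thesis by eventually_elim (simp add: J_def)
  qed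
  then have Z_lattice: "AE \<omega> in M. \<forall>k. Z k \<omega> = (real (J k \<omega>) - 1) * h" by (simp add: AE_all_countable)
  have p: "pmf jump_pmf 0 * jump_rate = G 0"
    using jump_rate_pos by (simp add: pmf_jump jump_prob_def)
  show thesis
  proof
    show "stopped_walk M jump_pmf J" by (rule SW.stopped_walk_axioms)
    show "AE \<omega> in M. (\<forall>i. 0 < E i \<omega>) \<and>
       (\<forall>t\<ge>0. Y t \<omega> = x + (\<Sum>k | (\<Sum>i\<le>k. E i \<omega>) \<le> t. (real (J k \<omega>) - 1) * h))"
      using E_pos Z_lattice Y by eventually_elim auto
    fix S :: "int set"
    assume S: "0 \<notin> S" and stop: "AE \<omega> in M. \<exists>n. fst (walk S (\<lambda>i. J i \<omega>) n) \<in> S"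
      and geo: "\<And>c. 1 \<le> c \<Longrightarrow> prob {\<omega> \<in> space M. length (snd (walk_end S (\<lambda>i. J i \<omega>))) = c} =
          (1 - pmf jump_pmf 0) ^ (c - 1) * pmf jump_pmf 0"
    \<comment> \<open>The visit list as a function of the raw jump sizes, the form in which the
      independence from \<open>E\<close> applies.\<close>
    let ?v = "\<lambda>z. snd (walk_end S (\<lambda>i. jump_index (z i)))"
    have [measurable]: "(\<lambda>z. walk_end S (\<lambda>i. jump_index (z i))) \<in> PiM UNIV (\<lambda>_. borel) \<rightarrow>\<^sub>M count_space UNIV"
      by (rule measurable_walk_end[of "\<lambda>i z. jump_index (z i)"]) measurable
    have "distributed M lborel (\<lambda>\<omega>. \<Sum>i\<in>set (?v (\<lambda>i. Z i \<omega>)). E i \<omega>)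
        (exponential_density (pmf jump_pmf 0 * jump_rate))"
    proof (rule geometric_sum_exponential[OF indep E jump_rate_pos])
      show "?v \<in> PiM UNIV (\<lambda>_. borel) \<rightarrow>\<^sub>M count_space UNIV"
        by (rule measurable_compose[of "\<lambda>z. walk_end S (\<lambda>i. jump_index (z i))" _ "count_space UNIV"]) measurable
      show "distinct (?v z)" for z by (rule walk_end_distinct)
      show "AE \<omega> in M. ?v (\<lambda>i. Z i \<omega>) \<noteq> []"
        using stop
      proof eventually_elim
        fix \<omega> assume "\<exists>n. fst (walk S (\<lambda>i. J i \<omega>) n) \<in> S"
        then obtain n where n: "fst (walk S (\<lambda>i. J i \<omega>) n) \<in> S" by blast
        with S obtain k where "n = Suc k" by (cases n) auto
        with walk_end_eq[OF n] walk_nonempty[OF S, of "\<lambda>i. J i \<omega>" k] show "?v (\<lambda>i. Z i \<omega>) \<noteq> []"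
          by (simp add: J_def)
      qed
      show "0 < pmf jump_pmf 0" by (rule p0_pos)
      show "pmf jump_pmf 0 \<le> 1" by (rule pmf_le_1)
      show "prob {\<omega> \<in> space M. length (?v (\<lambda>i. Z i \<omega>)) = c} = (1 - pmf jump_pmf 0) ^ (c - 1) * pmf jump_pmf 0"
        if "1 \<le> c" for c
        using geo[OF that] by (simp add: J_def)
    qed
    then show "distributed M lborel (\<lambda>\<omega>. \<Sum>i\<in>set (snd (walk_end S (\<lambda>i. J i \<omega>))). E i \<omega>) (exponential_density (G 0))"
      unfolding p by (simp add: J_def)
  qed
qed

text \<open>The tail is one minus a finite sum. Because \<open>1 \<le> j\<close>, that sum includes
  index 1, and replacing \<open>G 1\<close> by mass 0 adds \<open>jump_rate\<close> to the sum of
  the \<open>G i\<close>.\<close>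

lemma jump_tail:
  assumes "1 \<le> j"
  shows "measure (measure_pmf jump_pmf) {i. j < i} / pmf jump_pmf 0 = - (1 / G 0) * (\<Sum>i\<le>j. G i)"
proof -
  have "measure (measure_pmf jump_pmf) {..j} = (\<Sum>i\<le>j. jump_prob i)"
    by (simp add: measure_measure_pmf_finite pmf_jump)
  also have "\<dots> = ((\<Sum>i\<le>j. G i) + jump_rate) / jump_rate"
  proof -
    have "(\<Sum>i\<le>j. jump_prob i) = (\<Sum>i\<le>j. G i / jump_rate + (if i = 1 then 1 else 0))"
      using jump_rate_pos by (intro sum.cong) (auto simp: jump_prob_def jump_rate_def)
    also have "\<dots> = (\<Sum>i\<le>j. G i) / jump_rate + 1"
      using assms by (simp add: sum.distrib sum_divide_distrib)
    finally show ?thesis using jump_rate_pos by (simp add: field_simps)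
  qed
  finally have "measure (measure_pmf jump_pmf) {..j} = ((\<Sum>i\<le>j. G i) + jump_rate) / jump_rate" .
  moreover have "measure (measure_pmf jump_pmf) {i. j < i} = 1 - measure (measure_pmf jump_pmf) {..j}"
  proof -
    have "{i. j < i} = UNIV - {..j}" by auto
    then show ?thesis using measure_pmf.prob_compl[of "{..j}" jump_pmf] by simp
  qed
  moreover have "pmf jump_pmf 0 = G 0 / jump_rate" by (simp add: pmf_jump jump_prob_def)
  ultimately have "measure (measure_pmf jump_pmf) {i. j < i} / pmf jump_pmf 0 =
      (1 - ((\<Sum>i\<le>j. G i) + jump_rate) / jump_rate) / (G 0 / jump_rate)"
    by simp
  also have "\<dots> = - (1 / G 0) * (\<Sum>i\<le>j. G i)"
  proof -
    have "(1 - (s + l) / l) / (g / l) = - (1 / g) * s" if "l \<noteq> 0" for s l g :: real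
      using that by (simp add: add_divide_distrib)
    then show ?thesis using jump_rate_pos by simp
  qed
  finally show ?thesis .
qed

text \<open>The position \<open>- 1 + h + k * h\<close> is live exactly for
  \<open>k \<ge> 0\<close>, so with stopping set \<open>{1..}\<close> only the start is live before
  the passage. Ending at \<open>k = j\<close> means landing on
  \<open>- 1 + (1 + j) * h\<close>.\<close>

lemma Nl_first_jump:
  fixes M :: "'w measure"
  assumes "compound_poisson M (jump_measure \<phi> h) (- 1 + h) Y"
  shows "\<exists>T L :: 'w \<Rightarrow> real.
    (AE \<omega> in M. is_first_jump_time (Nl (\<lambda>t. Y t \<omega>)) (T \<omega>) \<and> L \<omega> = Nl (\<lambda>t. Y t \<omega>) (T \<omega>)) \<and>
    distributed M lborel T (exponential_density (G 0)) \<and>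
    L \<in> borel_measurable M \<and>
    (\<forall>j\<ge>1. measure M {\<omega> \<in> space M. L \<omega> = - 1 + (1 + real j) * h} = - (1 / G 0) * (\<Sum>i\<le>j. G i))"
proof -
  from compound_poisson_walk[OF assms] obtain E J where
    SW: "stopped_walk M jump_pmf J"
    and path: "AE \<omega> in M. (\<forall>i. 0 < E i \<omega>) \<and>
       (\<forall>t\<ge>0. Y t \<omega> = - 1 + h + (\<Sum>k | (\<Sum>i\<le>k. E i \<omega>) \<le> t. (real (J k \<omega>) - 1) * h))"
    and T: "\<And>S. 0 \<notin> S \<Longrightarrow> AE \<omega> in M. \<exists>n. fst (walk S (\<lambda>i. J i \<omega>) n) \<in> S \<Longrightarrow>
       (\<And>c. 1 \<le> c \<Longrightarrow> measure M {\<omega> \<in> space M. length (snd (walk_end S (\<lambda>i. J i \<omega>))) = c} =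
          (1 - pmf jump_pmf 0) ^ (c - 1) * pmf jump_pmf 0) \<Longrightarrow>
       distributed M lborel (\<lambda>\<omega>. \<Sum>i\<in>set (snd (walk_end S (\<lambda>i. J i \<omega>))). E i \<omega>) (exponential_density (G 0))"
    by blast
  interpret up_walk M jump_pmf J using SW by (rule up_walk.intro)
  define T' where "T' \<omega> = (\<Sum>i\<in>set (snd (W_end \<omega>)). E i \<omega>)" for \<omega>
  define L where "L \<omega> = - 1 + h + of_int (fst (W_end \<omega>)) * h" for \<omega>
  have "AE \<omega> in M. is_first_jump_time (Nl (\<lambda>t. Y t \<omega>)) (T' \<omega>) \<and> L \<omega> = Nl (\<lambda>t. Y t \<omega>) (T' \<omega>)"
    using path AE_stopped
  proof eventually_elim
    case (elim \<omega>)
    have live: "- 1 + h + of_int k * h \<in> {- 1<..} \<longleftrightarrow> 0 \<le> k" for k :: int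
    proof -
      have "- 1 + h + of_int k * h \<in> {- 1<..} \<longleftrightarrow> 0 < (1 + of_int k) * h" by (simp add: algebra_simps)
      also have "\<dots> \<longleftrightarrow> 0 \<le> k" using h_pos by (simp add: zero_less_mult_iff) linarith
      finally show ?thesis .
    qed
    have f: "\<And>t. 0 \<le> t \<Longrightarrow> Y t \<omega> = - 1 + h + (\<Sum>k | (\<Sum>i\<le>k. E i \<omega>) \<le> t. (real (J k \<omega>) - 1) * h)"
      and e: "\<And>i. 0 < E i \<omega>"
      using elim(1) by auto
    note jump = first_jump_walk[of "\<lambda>i. E i \<omega>" "\<lambda>t. Y t \<omega>" "- 1 + h" "\<lambda>i. J i \<omega>" h "{1..}" "{- 1<..}",
        OF e f elim(2) _ _ _ h_pos]
    have "is_first_jump_time (Nl (\<lambda>t. Y t \<omega>)) (T' \<omega>)"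
      unfolding Nl_def T'_def by (rule jump(1); (unfold live)?; simp; linarith?)
    moreover have "Nl (\<lambda>t. Y t \<omega>) (T' \<omega>) = L \<omega>"
      unfolding Nl_def T'_def L_def by (rule jump(2); (unfold live)?; simp; linarith?)
    ultimately show ?case by simp
  qed
  moreover have "distributed M lborel T' (exponential_density (G 0))"
    unfolding T'_def[abs_def] by (rule T[OF _ AE_stopped prob_visits]) auto
  moreover have "L \<in> borel_measurable M"
    unfolding L_def[abs_def] by (rule measurable_compose[OF W_end_measurable]) simp
  moreover have "prob {\<omega> \<in> space M. L \<omega> = - 1 + (1 + real j) * h} = - (1 / G 0) * (\<Sum>i\<le>j. G i)"
    if "1 \<le> j" for j
  proof -
    have "L \<omega> = - 1 + (1 + real j) * h \<longleftrightarrow> fst (W_end \<omega>) = int j" for \<omega>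
    proof -
      have "L \<omega> = - 1 + (1 + real j) * h \<longleftrightarrow> of_int (fst (W_end \<omega>)) * h = real j * h"
        by (simp add: L_def algebra_simps)
      also have "\<dots> \<longleftrightarrow> fst (W_end \<omega>) = int j"
        using h_pos by (metis mult_cancel_right of_int_eq_iff of_int_of_nat_eq less_irrefl)
      finally show ?thesis .
    qed
    then show ?thesis using prob_landing[of "int j"] jump_tail[OF that] that by simp
  qed
  ultimately show ?thesis by blast
qed

text \<open>The mirror case with stopping set \<open>{..<0}\<close>: \<open>1 - h + k * h\<close> is
  live exactly for \<open>k \<le> 0\<close>, and almost surely the passage ends at
  \<open>k = -1\<close>.\<close>

lemma Nr_first_jump:
  fixes M :: "'w measure"
  assumes "compound_poisson M (jump_measure \<phi> h) (1 - h) Y"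
  shows "\<exists>T :: 'w \<Rightarrow> real.
    (AE \<omega> in M. is_first_jump_time (Nr (\<lambda>t. Y t \<omega>)) (T \<omega>) \<and> Nr (\<lambda>t. Y t \<omega>) (T \<omega>) = 1 - 2 * h) \<and>
    distributed M lborel T (exponential_density (G 0))"
proof -
  from compound_poisson_walk[OF assms] obtain E J where
    SW: "stopped_walk M jump_pmf J"
    and path: "AE \<omega> in M. (\<forall>i. 0 < E i \<omega>) \<and>
       (\<forall>t\<ge>0. Y t \<omega> = 1 - h + (\<Sum>k | (\<Sum>i\<le>k. E i \<omega>) \<le> t. (real (J k \<omega>) - 1) * h))"
    and T: "\<And>S. 0 \<notin> S \<Longrightarrow> AE \<omega> in M. \<exists>n. fst (walk S (\<lambda>i. J i \<omega>) n) \<in> S \<Longrightarrow>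
       (\<And>c. 1 \<le> c \<Longrightarrow> measure M {\<omega> \<in> space M. length (snd (walk_end S (\<lambda>i. J i \<omega>))) = c} =
          (1 - pmf jump_pmf 0) ^ (c - 1) * pmf jump_pmf 0) \<Longrightarrow>
       distributed M lborel (\<lambda>\<omega>. \<Sum>i\<in>set (snd (walk_end S (\<lambda>i. J i \<omega>))). E i \<omega>) (exponential_density (G 0))"
    by blast
  interpret down_walk M jump_pmf J using SW by (rule down_walk.intro)
  define T' where "T' \<omega> = (\<Sum>i\<in>set (snd (W_end \<omega>)). E i \<omega>)" for \<omega>
  have "AE \<omega> in M. is_first_jump_time (Nr (\<lambda>t. Y t \<omega>)) (T' \<omega>) \<and> Nr (\<lambda>t. Y t \<omega>) (T' \<omega>) = 1 - 2 * h"
    using path AE_stopped AE_W_end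
  proof eventually_elim
    case (elim \<omega>)
    have live: "1 - h + of_int k * h \<in> {..<1} \<longleftrightarrow> k \<le> 0" for k :: int
    proof -
      have "1 - h + of_int k * h \<in> {..<1} \<longleftrightarrow> 0 < (1 - of_int k) * h" by (simp add: algebra_simps)
      also have "\<dots> \<longleftrightarrow> k \<le> 0" using h_pos by (simp add: zero_less_mult_iff) linarith
      finally show ?thesis .
    qed
    have f: "\<And>t. 0 \<le> t \<Longrightarrow> Y t \<omega> = 1 - h + (\<Sum>k | (\<Sum>i\<le>k. E i \<omega>) \<le> t. (real (J k \<omega>) - 1) * h)"
      and e: "\<And>i. 0 < E i \<omega>"
      using elim(1) by auto
    note jump = first_jump_walk[of "\<lambda>i. E i \<omega>" "\<lambda>t. Y t \<omega>" "1 - h" "\<lambda>i. J i \<omega>" h "{..<0}" "{..<1}",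
        OF e f elim(2) _ _ _ h_pos]
    have "is_first_jump_time (Nr (\<lambda>t. Y t \<omega>)) (T' \<omega>)"
      unfolding Nr_def T'_def by (rule jump(1); (unfold live)?; simp; linarith?)
    moreover have "Nr (\<lambda>t. Y t \<omega>) (T' \<omega>) = 1 - h + of_int (fst (W_end \<omega>)) * h"
      unfolding Nr_def T'_def by (rule jump(2); (unfold live)?; simp; linarith?)
    ultimately show ?case using elim(3) by simp
  qed
  moreover have "distributed M lborel T' (exponential_density (G 0))"
    unfolding T'_def[abs_def] by (rule T[OF _ AE_stopped prob_visits]) auto
  ultimately show ?thesis by blast
qed

end

theorem theorem4p10:
  fixes \<phi> :: "real measure" and h :: real
    and M :: "'w measure" and Y :: "real \<Rightarrow> 'w \<Rightarrow> real"
  assumes "sets \<phi> = sets (restrict_space borel {0<..})"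
    and "(\<integral>\<^sup>+ y. ennreal (min (y\<^sup>2) y) \<partial>\<phi>) < \<infinity>"
    and "(\<integral>\<^sup>+ y\<in>{0<..<1}. ennreal y \<partial>\<phi>) = \<infinity>"
    and "h > 0"
  shows "(compound_poisson M (jump_measure \<phi> h) (- 1 + h) Y \<longrightarrow>
      (\<exists>T L :: 'w \<Rightarrow> real.
         (AE \<omega> in M. is_first_jump_time (Nl (\<lambda>t. Y t \<omega>)) (T \<omega>) \<and>
                     L \<omega> = Nl (\<lambda>t. Y t \<omega>) (T \<omega>)) \<and>
         distributed M lborel T (exponential_density (Gcoeff \<phi> h 0)) \<and>
         L \<in> borel_measurable M \<and>
         (\<forall>j\<ge>1. measure M {\<omega> \<in> space M. L \<omega> = - 1 + (1 + real j) * h} =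
                  - (1 / Gcoeff \<phi> h 0) * (\<Sum>i\<le>j. Gcoeff \<phi> h i)))) \<and>
    (compound_poisson M (jump_measure \<phi> h) (1 - h) Y \<longrightarrow>
      (\<exists>T :: 'w \<Rightarrow> real.
         (AE \<omega> in M. is_first_jump_time (Nr (\<lambda>t. Y t \<omega>)) (T \<omega>) \<and>
                     Nr (\<lambda>t. Y t \<omega>) (T \<omega>) = 1 - 2 * h) \<and>
         distributed M lborel T (exponential_density (Gcoeff \<phi> h 0))))"
proof -
  interpret spectrally_positive \<phi> h
    using assms by (rule spectrally_positive.intro)
  show ?thesis
    unfolding Gcoeff_eq using Nl_first_jump Nr_first_jump by blast
qed

end
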